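(* Let $L$ be a Lie ring and $A$ an abelian Lie ring, regarded also as a trivial $L$-module. The assignment $E\mapsto C_E$ determines a bijective correspondence between the equivalence classes of central extensions of $L$ by $A$ and the second cohomology group $H^2(L,A)$. Furthermore, if $E$ is a split extension, then $C_E=0+B^2(L,A)$, the zero class.
   Context: A Lie ring is an additive abelian group with a biadditive bracket $[\cdot,\cdot]$ satisfying $[x,x]=0$ and the Jacobi identity. It is abelian if its bracket is zero. A central extension $E$ of $L$ by $A$ is a short exact sequence $0\to A\xrightarrow{\alpha}B\xrightarrow{\beta}L\to 0$ of Lie rings with $\alpha(A)\subseteq Z(B)$, where $Z(B)$ is the center of $B$. A section of $\beta$ is a map $\lambda:L\to B$ (not necessarily a homomorphism) with $\beta\circ\lambda=\mathrm{id}_L$; $E$ is split if some section is a Lie ring homomorphism. Two central extensions $0\to A\xrightarrow{\alpha}B\xrightarrow{\beta}L\to0$ and $0\to A\xrightarrow{\alpha'}B'\xrightarrow{\beta'}L\to0$ are equivalent if there is a Lie ring homomorphism $\gamma:B\to B'$ with $\gamma\circ\alpha=\alpha'$ and $\beta'\circ\gamma=\beta$. $Z^2(L,A)$ is the abelian group (pointwise addition) of all pairs $(f,g)$ of functions $f,g:L\times L\to A$ (called cocycles) such that for all $x,y,z\in L$: (1) $f(x+y,z)=f(x,z)+f(y,z)+g([x,z],[y,z])$ and $f(x,y+z)=f(x,y)+f(x,z)+g([x,y],[x,z])$; (2) $f(x,x)=0$; (3) $f(x,[y,z])+f(z,[x,y])+f(y,[z,x])=-g([x,[y,z]],[z,[x,y]])-g(-[y,[z,x]],[y,[z,x]])$;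 (4) $g(x+y,z)+g(x,y)=g(x,y+z)+g(y,z)$; (5) $g(x,y)=g(y,x)$. $B^2(L,A)$ is the subgroup of pairs $(f,g)$ of the form $f(x,y)=-t([x,y])$, $g(x,y)=t(x)+t(y)-t(x+y)$ for some map $t:L\to A$ with $t(0)=0$. $H^2(L,A)=Z^2(L,A)/B^2(L,A)$. The class $C_E$: identify $A$ with $\alpha(A)\subseteq B$, choose a section $\lambda$ of $\beta$ with $\lambda(0)=0$, and put $f(x,y)=[\lambda(x),\lambda(y)]-\lambda([x,y])\in A$ and $g(x,y)=\lambda(x)+\lambda(y)-\lambda(x+y)\in A$. Then $(f,g)\in Z^2(L,A)$ and $C_E$ is its class in $H^2(L,A)$, which does not depend on the choice of $\lambda$. *)

theory Defs
  imports "HOL-Algebra.AbelCoset" "HOL-Library.Equipollence"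
begin

(* Lie rings are carried by the ring records of HOL-Algebra: addition is the additive part of
   the record and the multiplication slot holds the bracket, so that [x,y] is written
   x \<otimes> y. The slot for the unit element is never referred to. *)
locale lie_ring = abelian_group L for L (structure) +
  assumes bracket_closed:
      "\<lbrakk>x \<in> carrier L; y \<in> carrier L\<rbrakk> \<Longrightarrow> x \<otimes> y \<in> carrier L"
    and bracket_add_left:
      "\<lbrakk>x \<in> carrier L; y \<in> carrier L; z \<in> carrier L\<rbrakk> \<Longrightarrow>
        (x \<oplus> y) \<otimes> z = (x \<otimes> z) \<oplus> (y \<otimes> z)"
    and bracket_add_right:
      "\<lbrakk>x \<in> carrier L; y \<in> carrier L; z \<in> carrier L\<rbrakk> \<Longrightarrow>
        x \<otimes> (y \<oplus> z) = (x \<otimes> y) \<oplus> (x \<otimes> z)"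
    and bracket_self:
      "x \<in> carrier L \<Longrightarrow> x \<otimes> x = \<zero>"
    and jacobi:
      "\<lbrakk>x \<in> carrier L; y \<in> carrier L; z \<in> carrier L\<rbrakk> \<Longrightarrow>
        (x \<otimes> (y \<otimes> z)) \<oplus> (y \<otimes> (z \<otimes> x)) \<oplus> (z \<otimes> (x \<otimes> y)) = \<zero>"

locale abelian_lie_ring = lie_ring +
  assumes bracket_zero:
      "\<lbrakk>x \<in> carrier L; y \<in> carrier L\<rbrakk> \<Longrightarrow> x \<otimes> y = \<zero>"

definition lie_center :: "'b ring \<Rightarrow> 'b set" where
  "lie_center B = {z \<in> carrier B. \<forall>x \<in> carrier B. z \<otimes>\<^bsub>B\<^esub> x = \<zero>\<^bsub>B\<^esub>}"

definition lie_hom :: "'b ring \<Rightarrow> 'c ring \<Rightarrow> ('b \<Rightarrow> 'c) set" where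
  "lie_hom B C = {h \<in> carrier B \<rightarrow> carrier C.
     \<forall>x \<in> carrier B. \<forall>y \<in> carrier B.
       h (x \<oplus>\<^bsub>B\<^esub> y) = h x \<oplus>\<^bsub>C\<^esub> h y \<and> h (x \<otimes>\<^bsub>B\<^esub> y) = h x \<otimes>\<^bsub>C\<^esub> h y}"


record ('a, 'b, 'l) extension =
  mid :: "'b ring"
  incl :: "'a \<Rightarrow> 'b"
  proj :: "'b \<Rightarrow> 'l"

definition central_extension ::
    "'l ring \<Rightarrow> 'a ring \<Rightarrow> ('a, 'b, 'l) extension \<Rightarrow> bool" where
  "central_extension L A E \<longleftrightarrow>
     lie_ring (mid E) \<and>
     incl E \<in> lie_hom A (mid E) \<and>
     proj E \<in> lie_hom (mid E) L \<and>
     inj_on (incl E) (carrier A) \<and>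
     incl E ` carrier A = a_kernel (mid E) L (proj E) \<and>
     proj E ` carrier (mid E) = carrier L \<and>
     incl E ` carrier A \<subseteq> lie_center (mid E)"

definition central_extensions ::
    "'l ring \<Rightarrow> 'a ring \<Rightarrow> ('a, 'b, 'l) extension set" where
  "central_extensions L A = {E. central_extension L A E}"

(* The middle Lie rings may live in different types. *)
definition equivalent_ext ::
    "'l ring \<Rightarrow> 'a ring \<Rightarrow> ('a, 'b, 'l) extension \<Rightarrow> ('a, 'c, 'l) extension \<Rightarrow> bool" where
  "equivalent_ext L A E E' \<longleftrightarrow>
     (\<exists>\<gamma> \<in> lie_hom (mid E) (mid E').
        (\<forall>a \<in> carrier A. \<gamma> (incl E a) = incl E' a) \<and>
        (\<forall>b \<in> carrier (mid E). proj E' (\<gamma> b) = proj E b))"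

definition ext_equiv ::
    "'l ring \<Rightarrow> 'a ring \<Rightarrow> (('a, 'b, 'l) extension \<times> ('a, 'b, 'l) extension) set" where
  "ext_equiv L A = {(E, E'). E \<in> central_extensions L A \<and> E' \<in> central_extensions L A \<and>
     equivalent_ext L A E E'}"

definition sections :: "'l ring \<Rightarrow> ('a, 'b, 'l) extension \<Rightarrow> ('l \<Rightarrow> 'b) set" where
  "sections L E = {s \<in> carrier L \<rightarrow> carrier (mid E). \<forall>x \<in> carrier L. proj E (s x) = x}"

definition split_ext :: "'l ring \<Rightarrow> ('a, 'b, 'l) extension \<Rightarrow> bool" where
  "split_ext L E \<longleftrightarrow> (\<exists>s \<in> sections L E. s \<in> lie_hom L (mid E))"


type_synonym ('l, 'a) cochain = "('l \<times> 'l \<Rightarrow> 'a) \<times> ('l \<times> 'l \<Rightarrow> 'a)"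

(* Functions L \<times> L \<rightarrow> A are represented by HOL functions that take the value undefined
   outside carrier L \<times> carrier L, so that equality of cocycles is equality on the carrier. *)
definition Z2_set :: "'l ring \<Rightarrow> 'a ring \<Rightarrow> ('l, 'a) cochain set" where
  "Z2_set L A = {(f, g).
     f \<in> carrier L \<times> carrier L \<rightarrow>\<^sub>E carrier A \<and>
     g \<in> carrier L \<times> carrier L \<rightarrow>\<^sub>E carrier A \<and>
     (\<forall>x \<in> carrier L. \<forall>y \<in> carrier L. \<forall>z \<in> carrier L.
        f (x \<oplus>\<^bsub>L\<^esub> y, z) = f (x, z) \<oplus>\<^bsub>A\<^esub> f (y, z) \<oplus>\<^bsub>A\<^esub> g (x \<otimes>\<^bsub>L\<^esub> z, y \<otimes>\<^bsub>L\<^esub> z) \<and>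
        f (x, y \<oplus>\<^bsub>L\<^esub> z) = f (x, y) \<oplus>\<^bsub>A\<^esub> f (x, z) \<oplus>\<^bsub>A\<^esub> g (x \<otimes>\<^bsub>L\<^esub> y, x \<otimes>\<^bsub>L\<^esub> z) \<and>
        f (x, x) = \<zero>\<^bsub>A\<^esub> \<and>
        f (x, y \<otimes>\<^bsub>L\<^esub> z) \<oplus>\<^bsub>A\<^esub> f (z, x \<otimes>\<^bsub>L\<^esub> y) \<oplus>\<^bsub>A\<^esub> f (y, z \<otimes>\<^bsub>L\<^esub> x) =
          (\<ominus>\<^bsub>A\<^esub> g (x \<otimes>\<^bsub>L\<^esub> (y \<otimes>\<^bsub>L\<^esub> z), z \<otimes>\<^bsub>L\<^esub> (x \<otimes>\<^bsub>L\<^esub> y)))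
          \<ominus>\<^bsub>A\<^esub> g (\<ominus>\<^bsub>L\<^esub> (y \<otimes>\<^bsub>L\<^esub> (z \<otimes>\<^bsub>L\<^esub> x)), y \<otimes>\<^bsub>L\<^esub> (z \<otimes>\<^bsub>L\<^esub> x)) \<and>
        g (x \<oplus>\<^bsub>L\<^esub> y, z) \<oplus>\<^bsub>A\<^esub> g (x, y) = g (x, y \<oplus>\<^bsub>L\<^esub> z) \<oplus>\<^bsub>A\<^esub> g (y, z) \<and>
        g (x, y) = g (y, x))}"

definition Z2 :: "'l ring \<Rightarrow> 'a ring \<Rightarrow> ('l, 'a) cochain monoid" where
  "Z2 L A =
     \<lparr>carrier = Z2_set L A,
      mult = (\<lambda>(f, g) (f', g').
        (\<lambda>p \<in> carrier L \<times> carrier L. f p \<oplus>\<^bsub>A\<^esub> f' p,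
         \<lambda>p \<in> carrier L \<times> carrier L. g p \<oplus>\<^bsub>A\<^esub> g' p)),
      one = (\<lambda>p \<in> carrier L \<times> carrier L. \<zero>\<^bsub>A\<^esub>, \<lambda>p \<in> carrier L \<times> carrier L. \<zero>\<^bsub>A\<^esub>)\<rparr>"

definition coboundary :: "'l ring \<Rightarrow> 'a ring \<Rightarrow> ('l \<Rightarrow> 'a) \<Rightarrow> ('l, 'a) cochain" where
  "coboundary L A t =
     (\<lambda>(x, y) \<in> carrier L \<times> carrier L. \<ominus>\<^bsub>A\<^esub> t (x \<otimes>\<^bsub>L\<^esub> y),
      \<lambda>(x, y) \<in> carrier L \<times> carrier L. t x \<oplus>\<^bsub>A\<^esub> t y \<ominus>\<^bsub>A\<^esub> t (x \<oplus>\<^bsub>L\<^esub> y))"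

definition B2 :: "'l ring \<Rightarrow> 'a ring \<Rightarrow> ('l, 'a) cochain set" where
  "B2 L A = {coboundary L A t | t. t \<in> carrier L \<rightarrow> carrier A \<and> t \<zero>\<^bsub>L\<^esub> = \<zero>\<^bsub>A\<^esub>}"

definition H2 :: "'l ring \<Rightarrow> 'a ring \<Rightarrow> ('l, 'a) cochain set monoid" where
  "H2 L A = Z2 L A Mod B2 L A"


(* inv_into (carrier A) (incl E) expresses the identification of A with its image in B. *)
definition section_cocycle ::
    "'l ring \<Rightarrow> 'a ring \<Rightarrow> ('a, 'b, 'l) extension \<Rightarrow> ('l \<Rightarrow> 'b) \<Rightarrow> ('l, 'a) cochain" where
  "section_cocycle L A E s =
     (\<lambda>(x, y) \<in> carrier L \<times> carrier L. inv_into (carrier A) (incl E)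
        ((s x \<otimes>\<^bsub>mid E\<^esub> s y) \<ominus>\<^bsub>mid E\<^esub> s (x \<otimes>\<^bsub>L\<^esub> y)),
      \<lambda>(x, y) \<in> carrier L \<times> carrier L. inv_into (carrier A) (incl E)
        ((s x \<oplus>\<^bsub>mid E\<^esub> s y) \<ominus>\<^bsub>mid E\<^esub> s (x \<oplus>\<^bsub>L\<^esub> y)))"

(* The definite description reflects that the class is the same for all normalised sections. *)
definition ext_class ::
    "'l ring \<Rightarrow> 'a ring \<Rightarrow> ('a, 'b, 'l) extension \<Rightarrow> ('l, 'a) cochain set" where
  "ext_class L A E =
     (THE c. \<exists>s \<in> sections L E. s \<zero>\<^bsub>L\<^esub> = \<zero>\<^bsub>mid E\<^esub> \<and>
        c = B2 L A #>\<^bsub>Z2 L A\<^esub> section_cocycle L A E s)"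

end

theory Submission
  imports Defs
begin

text \<open>A normalised section \<open>s\<close> of a central extension identifies its middle ring with
  \<open>A \<times> L\<close>, and its cocycle \<open>(f, g)\<close> records how bracket and addition deviate from being
  componentwise: \<open>[s x, s y] = f (x, y) + s [x, y]\<close> and \<open>s x + s y = g (x, y) + s (x + y)\<close>.
  The Lie ring axioms become the cocycle identities, and replacing \<open>s\<close> by \<open>t + s\<close> adds the
  coboundary of \<open>t\<close>. Hence two extensions have the same class iff they admit sections with the
  same cocycle, and this happens iff they are equivalent: an equivalence carries sections to sections, and
  conversely \<open>a + s x \<mapsto> a + s' x\<close> is a homomorphism. Every cocycle arises
  from the operations it prescribes on \<open>A \<times> L\<close>, which can be moved along an injection into any type that is
  large enough.\<close>

text \<open>The class is defined through preimages under \<open>incl E\<close> and differences in B,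
  neither of which is convenient to calculate with. Computations therefore go through
  \<open>represents\<close>, whose equations bring sums and brackets of section values to the form i
  a + s x; in two such expressions with the same s x, this value cancels and elements of A are
  compared. Centrality of i(A) means that brackets do not see A-coordinates.

  Equality of classes yields equal cocycles only up to a coboundary. The gap is closed by moving the
  section: every member of the coset \<open>ext_class L A E\<close> is the exact cocycle of some
  normalised section. Equivalence thus becomes the kernel relation of the class map, and its
  symmetry requires no inversion of the middle map.

  All extensions together do not form a HOL set, so middle rings range over one type 'b. The carrier
  of any middle ring is in bijection with A x L, hence the hypothesis \<open>universe\<close> says
  that 'b has room for one.\<close>

context abelian_group
begin

text \<open>HOL-Algebra registers its normaliser \<open>algebra\<close> only for rings and semirings.\<close>

lemmas abelian_group_simprules
  [algebra abelian_group "zero G" "add G" "a_inv G" "a_minus G"] =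
  a_closed zero_closed a_inv_closed minus_closed a_assoc l_zero l_neg a_comm minus_eq
  r_zero r_neg r_neg2 r_neg1 minus_add minus_minus minus_zero a_lcomm

text \<open>The Jacobi condition on cocycles is the only one with differences in A.
  \<open>Z2_I\<close> and \<open>Z2_D\<close> state it as a sum equal to zero, which can be
  rearranged by associativity and commutativity alone.\<close>

lemma eq_minus_minus_iff:
  assumes "a \<in> carrier G" "b \<in> carrier G" "c \<in> carrier G"
  shows "a = (\<ominus> b) \<ominus> c \<longleftrightarrow> a \<oplus> (b \<oplus> c) = \<zero>"
proof -
  have "(\<ominus> b) \<ominus> c = \<ominus> (b \<oplus> c)"
    using assms by (simp add: minus_eq minus_add)
  then show ?thesis
    using assms by (metis a_closed a_inv_closed l_neg minus_equality minus_minus)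
qed

end

section \<open>Bracket identities and homomorphic images of Lie rings\<close>

context lie_ring
begin

lemma bracket_zero_left [simp]: "x \<in> carrier L \<Longrightarrow> \<zero> \<otimes> x = \<zero>"
  using bracket_add_left[of \<zero> \<zero> x] bracket_closed[of \<zero> x]
  by (metis add.r_cancel_one' l_zero zero_closed)

lemma bracket_zero_right [simp]: "x \<in> carrier L \<Longrightarrow> x \<otimes> \<zero> = \<zero>"
  using bracket_add_right[of x \<zero> \<zero>] bracket_closed[of x \<zero>]
  by (metis add.r_cancel_one' l_zero zero_closed)

lemma bracket_antisym:
  assumes "x \<in> carrier L" "y \<in> carrier L"
  shows "(x \<otimes> y) \<oplus> (y \<otimes> x) = \<zero>"
proof -
  have "\<zero> = (x \<oplus> y) \<otimes> (x \<oplus> y)"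
    using assms by (simp add: bracket_self)
  also have "\<dots> = (x \<otimes> y) \<oplus> (y \<otimes> x)"
    using assms by (simp add: bracket_add_left bracket_add_right bracket_closed) (simp add: bracket_self bracket_closed a_comm)
  finally show ?thesis by simp
qed

text \<open>The Jacobi identity solved for \<open>y \<otimes> (z \<otimes> x)\<close>, matching the
  arguments of g in the Jacobi condition on cocycles: first the two summands on the left, then the
  right side and its negative.\<close>

lemma bracket_cyclic:
  assumes "x \<in> carrier L" "y \<in> carrier L" "z \<in> carrier L"
  shows "(x \<otimes> (y \<otimes> z)) \<oplus> (z \<otimes> (x \<otimes> y)) = \<ominus> (y \<otimes> (z \<otimes> x))"
proof -
  have "(x \<otimes> (y \<otimes> z)) \<oplus> (z \<otimes> (x \<otimes> y)) \<oplus> (y \<otimes> (z \<otimes> x)) = \<zero>"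
    using jacobi[OF assms] assms by (simp add: bracket_closed a_ac)
  then show ?thesis
    using assms by (simp add: bracket_closed minus_equality)
qed

end

text \<open>\<open>lie_center\<close> asks for vanishing on one side; antisymmetry supplies the
  other.\<close>

lemma lie_center_bracket:
  assumes "lie_ring L" "z \<in> lie_center L" "x \<in> carrier L"
  shows "z \<otimes>\<^bsub>L\<^esub> x = \<zero>\<^bsub>L\<^esub>" "x \<otimes>\<^bsub>L\<^esub> z = \<zero>\<^bsub>L\<^esub>"
proof -
  interpret lie_ring L by fact
  show "z \<otimes>\<^bsub>L\<^esub> x = \<zero>\<^bsub>L\<^esub>"
    using assms by (simp add: lie_center_def)
  with bracket_antisym[of z x] assms show "x \<otimes>\<^bsub>L\<^esub> z = \<zero>\<^bsub>L\<^esub>"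
    by (simp add: lie_center_def bracket_closed)
qed

text \<open>The axioms are equations, hence pass to a homomorphic image. The condition on zero is
  assumed because \<open>C\<close> is not yet known to be a group, so it cannot be derived from
  additivity by cancellation.\<close>

lemma lie_ring_transport:
  fixes B :: "'b ring" and C :: "'c ring"
  assumes "lie_ring B" and h: "h \<in> lie_hom B C"
    and im: "h ` carrier B = carrier C" and zero: "h \<zero>\<^bsub>B\<^esub> = \<zero>\<^bsub>C\<^esub>"
  shows "lie_ring C"
proof -
  interpret B: lie_ring B by fact
  have add: "h x \<oplus>\<^bsub>C\<^esub> h y = h (x \<oplus>\<^bsub>B\<^esub> y)"
    and br: "h x \<otimes>\<^bsub>C\<^esub> h y = h (x \<otimes>\<^bsub>B\<^esub> y)"
    if "x \<in> carrier B" "y \<in> carrier B" for x y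
    using h that by (auto simp: lie_hom_def)
  have C: "carrier C = h ` carrier B" using im by simp
  have "abelian_group C"
  proof (rule abelian_groupI)
    fix x assume "x \<in> carrier C"
    then obtain b where b: "b \<in> carrier B" "x = h b" by (auto simp: C)
    then have "h (\<ominus>\<^bsub>B\<^esub> b) \<oplus>\<^bsub>C\<^esub> x = \<zero>\<^bsub>C\<^esub>" 
      by (simp add: add B.l_neg zero)
    then show "\<exists>y\<in>carrier C. y \<oplus>\<^bsub>C\<^esub> x = \<zero>\<^bsub>C\<^esub>"
      using b by (auto simp: C)
  qed (auto simp: C add zero[symmetric] B.a_ac)
  then interpret C: abelian_group C .
  show ?thesis
    by unfold_locales
      (auto simp: C add br zero[symmetric] B.bracket_closed B.bracket_add_left
        B.bracket_add_right B.bracket_self B.jacobi)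
qed

section \<open>The group of cocycles and the subgroup of coboundaries\<close>

locale lie_pair = L: lie_ring L + A: abelian_lie_ring A
  for L :: "'l ring" and A :: "'a ring"
begin

lemma Z2_I:
  assumes "f \<in> carrier L \<times> carrier L \<rightarrow>\<^sub>E carrier A"
    and "g \<in> carrier L \<times> carrier L \<rightarrow>\<^sub>E carrier A"
    and "\<And>x y z. \<lbrakk>x \<in> carrier L; y \<in> carrier L; z \<in> carrier L\<rbrakk> \<Longrightarrow>
      f (x \<oplus>\<^bsub>L\<^esub> y, z) = f (x, z) \<oplus>\<^bsub>A\<^esub> f (y, z) \<oplus>\<^bsub>A\<^esub> g (x \<otimes>\<^bsub>L\<^esub> z, y \<otimes>\<^bsub>L\<^esub> z)"
    and "\<And>x y z. \<lbrakk>x \<in> carrier L; y \<in> carrier L; z \<in> carrier L\<rbrakk> \<Longrightarrow>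
      f (x, y \<oplus>\<^bsub>L\<^esub> z) = f (x, y) \<oplus>\<^bsub>A\<^esub> f (x, z) \<oplus>\<^bsub>A\<^esub> g (x \<otimes>\<^bsub>L\<^esub> y, x \<otimes>\<^bsub>L\<^esub> z)"
    and "\<And>x. x \<in> carrier L \<Longrightarrow> f (x, x) = \<zero>\<^bsub>A\<^esub>"
    and "\<And>x y z. \<lbrakk>x \<in> carrier L; y \<in> carrier L; z \<in> carrier L\<rbrakk> \<Longrightarrow>
      (f (x, y \<otimes>\<^bsub>L\<^esub> z) \<oplus>\<^bsub>A\<^esub> f (z, x \<otimes>\<^bsub>L\<^esub> y) \<oplus>\<^bsub>A\<^esub> f (y, z \<otimes>\<^bsub>L\<^esub> x)) \<oplus>\<^bsub>A\<^esub>
        (g (x \<otimes>\<^bsub>L\<^esub> (y \<otimes>\<^bsub>L\<^esub> z), z \<otimes>\<^bsub>L\<^esub> (x \<otimes>\<^bsub>L\<^esub> y)) \<oplus>\<^bsub>A\<^esub>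
         g (\<ominus>\<^bsub>L\<^esub> (y \<otimes>\<^bsub>L\<^esub> (z \<otimes>\<^bsub>L\<^esub> x)), y \<otimes>\<^bsub>L\<^esub> (z \<otimes>\<^bsub>L\<^esub> x))) = \<zero>\<^bsub>A\<^esub>"
    and "\<And>x y z. \<lbrakk>x \<in> carrier L; y \<in> carrier L; z \<in> carrier L\<rbrakk> \<Longrightarrow>
      g (x \<oplus>\<^bsub>L\<^esub> y, z) \<oplus>\<^bsub>A\<^esub> g (x, y) = g (x, y \<oplus>\<^bsub>L\<^esub> z) \<oplus>\<^bsub>A\<^esub> g (y, z)"
    and "\<And>x y. \<lbrakk>x \<in> carrier L; y \<in> carrier L\<rbrakk> \<Longrightarrow> g (x, y) = g (y, x)"
  shows "(f, g) \<in> Z2_set L A"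
proof -
  have "f p \<in> carrier A" "g p \<in> carrier A" if "p \<in> carrier L \<times> carrier L" for p
    using assms(1,2) that by auto
  then show ?thesis
    unfolding Z2_set_def mem_Collect_eq prod.case
    using assms
    by (intro conjI ballI) (simp_all add: A.eq_minus_minus_iff L.bracket_closed)
qed

lemma Z2_D:
  assumes "(f, g) \<in> Z2_set L A"
  shows "f \<in> carrier L \<times> carrier L \<rightarrow>\<^sub>E carrier A"
    and "g \<in> carrier L \<times> carrier L \<rightarrow>\<^sub>E carrier A"
    and "\<lbrakk>x \<in> carrier L; y \<in> carrier L\<rbrakk> \<Longrightarrow> f (x, y) \<in> carrier A"
    and "\<lbrakk>x \<in> carrier L; y \<in> carrier L\<rbrakk> \<Longrightarrow> g (x, y) \<in> carrier A"
    and "\<lbrakk>x \<in> carrier L; y \<in> carrier L; z \<in> carrier L\<rbrakk> \<Longrightarrow>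
      f (x \<oplus>\<^bsub>L\<^esub> y, z) = f (x, z) \<oplus>\<^bsub>A\<^esub> f (y, z) \<oplus>\<^bsub>A\<^esub> g (x \<otimes>\<^bsub>L\<^esub> z, y \<otimes>\<^bsub>L\<^esub> z)"
    and "\<lbrakk>x \<in> carrier L; y \<in> carrier L; z \<in> carrier L\<rbrakk> \<Longrightarrow>
      f (x, y \<oplus>\<^bsub>L\<^esub> z) = f (x, y) \<oplus>\<^bsub>A\<^esub> f (x, z) \<oplus>\<^bsub>A\<^esub> g (x \<otimes>\<^bsub>L\<^esub> y, x \<otimes>\<^bsub>L\<^esub> z)"
    and "x \<in> carrier L \<Longrightarrow> f (x, x) = \<zero>\<^bsub>A\<^esub>"
    and "\<lbrakk>x \<in> carrier L; y \<in> carrier L; z \<in> carrier L\<rbrakk> \<Longrightarrow>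
      (f (x, y \<otimes>\<^bsub>L\<^esub> z) \<oplus>\<^bsub>A\<^esub> f (z, x \<otimes>\<^bsub>L\<^esub> y) \<oplus>\<^bsub>A\<^esub> f (y, z \<otimes>\<^bsub>L\<^esub> x)) \<oplus>\<^bsub>A\<^esub>
        (g (x \<otimes>\<^bsub>L\<^esub> (y \<otimes>\<^bsub>L\<^esub> z), z \<otimes>\<^bsub>L\<^esub> (x \<otimes>\<^bsub>L\<^esub> y)) \<oplus>\<^bsub>A\<^esub>
         g (\<ominus>\<^bsub>L\<^esub> (y \<otimes>\<^bsub>L\<^esub> (z \<otimes>\<^bsub>L\<^esub> x)), y \<otimes>\<^bsub>L\<^esub> (z \<otimes>\<^bsub>L\<^esub> x))) = \<zero>\<^bsub>A\<^esub>"
    and "\<lbrakk>x \<in> carrier L; y \<in> carrier L; z \<in> carrier L\<rbrakk> \<Longrightarrow>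
      g (x \<oplus>\<^bsub>L\<^esub> y, z) \<oplus>\<^bsub>A\<^esub> g (x, y) = g (x, y \<oplus>\<^bsub>L\<^esub> z) \<oplus>\<^bsub>A\<^esub> g (y, z)"
    and "\<lbrakk>x \<in> carrier L; y \<in> carrier L\<rbrakk> \<Longrightarrow> g (x, y) = g (y, x)"
proof -
  show "f \<in> carrier L \<times> carrier L \<rightarrow>\<^sub>E carrier A"
    and "g \<in> carrier L \<times> carrier L \<rightarrow>\<^sub>E carrier A"
    using assms by (simp_all add: Z2_set_def)
  then have *: "f p \<in> carrier A" "g p \<in> carrier A" if "p \<in> carrier L \<times> carrier L" for p
    using that by auto
  then show "\<lbrakk>x \<in> carrier L; y \<in> carrier L\<rbrakk> \<Longrightarrow> f (x, y) \<in> carrier A"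
    and "\<lbrakk>x \<in> carrier L; y \<in> carrier L\<rbrakk> \<Longrightarrow> g (x, y) \<in> carrier A"
    by simp_all
  show "(f (x, y \<otimes>\<^bsub>L\<^esub> z) \<oplus>\<^bsub>A\<^esub> f (z, x \<otimes>\<^bsub>L\<^esub> y) \<oplus>\<^bsub>A\<^esub> f (y, z \<otimes>\<^bsub>L\<^esub> x)) \<oplus>\<^bsub>A\<^esub>
        (g (x \<otimes>\<^bsub>L\<^esub> (y \<otimes>\<^bsub>L\<^esub> z), z \<otimes>\<^bsub>L\<^esub> (x \<otimes>\<^bsub>L\<^esub> y)) \<oplus>\<^bsub>A\<^esub>
         g (\<ominus>\<^bsub>L\<^esub> (y \<otimes>\<^bsub>L\<^esub> (z \<otimes>\<^bsub>L\<^esub> x)), y \<otimes>\<^bsub>L\<^esub> (z \<otimes>\<^bsub>L\<^esub> x))) = \<zero>\<^bsub>A\<^esub>"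
    if "x \<in> carrier L" "y \<in> carrier L" "z \<in> carrier L"
    using assms that unfolding Z2_set_def mem_Collect_eq prod.case
    by (subst A.eq_minus_minus_iff[symmetric]) (auto simp: * L.bracket_closed)
qed (use assms in \<open>unfold Z2_set_def mem_Collect_eq prod.case, blast+\<close>)


lemma mult_Z2:
  "(f, g) \<otimes>\<^bsub>Z2 L A\<^esub> (f', g') =
    (\<lambda>p \<in> carrier L \<times> carrier L. f p \<oplus>\<^bsub>A\<^esub> f' p, \<lambda>p \<in> carrier L \<times> carrier L. g p \<oplus>\<^bsub>A\<^esub> g' p)"
  by (simp add: Z2_def)

lemma carrier_Z2 [simp]: "carrier (Z2 L A) = Z2_set L A"
  by (simp add: Z2_def)

lemma one_Z2: "\<one>\<^bsub>Z2 L A\<^esub> =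
    (\<lambda>p \<in> carrier L \<times> carrier L. \<zero>\<^bsub>A\<^esub>, \<lambda>p \<in> carrier L \<times> carrier L. \<zero>\<^bsub>A\<^esub>)"
  by (simp add: Z2_def)

text \<open>Every cocycle condition is linear in the pair (f, g), so adding the instances for two
  cocycles gives the instance for their sum, up to regrouping.\<close>

lemma Z2_mult_closed:
  assumes 1: "(f, g) \<in> Z2_set L A" and 2: "(f', g') \<in> Z2_set L A"
  shows "(f, g) \<otimes>\<^bsub>Z2 L A\<^esub> (f', g') \<in> Z2_set L A"
proof -
  note [simp] = Z2_D(3,4)[OF 1] Z2_D(3,4)[OF 2] L.bracket_closed
  show ?thesis
    unfolding mult_Z2
  proof (rule Z2_I, goal_cases)
    case (6 x y z)
    note e = Z2_D(8)[OF 1 6] Z2_D(8)[OF 2 6]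
    \<comment> \<open>Stated for arbitrary elements, so that the regrouping does not touch the
      arguments of f and g.\<close>
    have "(a \<oplus>\<^bsub>A\<^esub> a' \<oplus>\<^bsub>A\<^esub> (b \<oplus>\<^bsub>A\<^esub> b') \<oplus>\<^bsub>A\<^esub> (c \<oplus>\<^bsub>A\<^esub> c')) \<oplus>\<^bsub>A\<^esub> (d \<oplus>\<^bsub>A\<^esub> d' \<oplus>\<^bsub>A\<^esub> (e \<oplus>\<^bsub>A\<^esub> e')) = \<zero>\<^bsub>A\<^esub>"
      if "(a \<oplus>\<^bsub>A\<^esub> b \<oplus>\<^bsub>A\<^esub> c) \<oplus>\<^bsub>A\<^esub> (d \<oplus>\<^bsub>A\<^esub> e) = \<zero>\<^bsub>A\<^esub>" "(a' \<oplus>\<^bsub>A\<^esub> b' \<oplus>\<^bsub>A\<^esub> c') \<oplus>\<^bsub>A\<^esub> (d' \<oplus>\<^bsub>A\<^esub> e') = \<zero>\<^bsub>A\<^esub>"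
        and [simp]: "a \<in> carrier A" "b \<in> carrier A" "c \<in> carrier A" "d \<in> carrier A" "e \<in> carrier A"
          "a' \<in> carrier A" "b' \<in> carrier A" "c' \<in> carrier A" "d' \<in> carrier A" "e' \<in> carrier A"
      for a b c d e a' b' c' d' e'
    proof -
      have "(a \<oplus>\<^bsub>A\<^esub> a' \<oplus>\<^bsub>A\<^esub> (b \<oplus>\<^bsub>A\<^esub> b') \<oplus>\<^bsub>A\<^esub> (c \<oplus>\<^bsub>A\<^esub> c')) \<oplus>\<^bsub>A\<^esub> (d \<oplus>\<^bsub>A\<^esub> d' \<oplus>\<^bsub>A\<^esub> (e \<oplus>\<^bsub>A\<^esub> e')) =
        ((a \<oplus>\<^bsub>A\<^esub> b \<oplus>\<^bsub>A\<^esub> c) \<oplus>\<^bsub>A\<^esub> (d \<oplus>\<^bsub>A\<^esub> e)) \<oplus>\<^bsub>A\<^esub> ((a' \<oplus>\<^bsub>A\<^esub> b' \<oplus>\<^bsub>A\<^esub> c') \<oplus>\<^bsub>A\<^esub> (d' \<oplus>\<^bsub>A\<^esub> e'))"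
        by (simp add: A.a_ac)
      then show ?thesis by (simp add: that)
    qed
    from this[OF e] 6 show ?case by simp
  next
    case (7 x y z)
    note e = Z2_D(9)[OF 1 7] Z2_D(9)[OF 2 7]
    have "a \<oplus>\<^bsub>A\<^esub> a' \<oplus>\<^bsub>A\<^esub> (b \<oplus>\<^bsub>A\<^esub> b') = c \<oplus>\<^bsub>A\<^esub> c' \<oplus>\<^bsub>A\<^esub> (d \<oplus>\<^bsub>A\<^esub> d')"
      if "a \<oplus>\<^bsub>A\<^esub> b = c \<oplus>\<^bsub>A\<^esub> d" "a' \<oplus>\<^bsub>A\<^esub> b' = c' \<oplus>\<^bsub>A\<^esub> d'"
        and [simp]: "a \<in> carrier A" "b \<in> carrier A" "c \<in> carrier A" "d \<in> carrier A"
          "a' \<in> carrier A" "b' \<in> carrier A" "c' \<in> carrier A" "d' \<in> carrier A"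
      for a b c d a' b' c' d'
    proof -
      have "a \<oplus>\<^bsub>A\<^esub> a' \<oplus>\<^bsub>A\<^esub> (b \<oplus>\<^bsub>A\<^esub> b') = (a \<oplus>\<^bsub>A\<^esub> b) \<oplus>\<^bsub>A\<^esub> (a' \<oplus>\<^bsub>A\<^esub> b')"
        by (simp add: A.a_ac)
      also have "\<dots> = c \<oplus>\<^bsub>A\<^esub> c' \<oplus>\<^bsub>A\<^esub> (d \<oplus>\<^bsub>A\<^esub> d')"
        unfolding that(1,2) by (simp add: A.a_ac)
      finally show ?thesis .
    qed
    from this[OF e] 7 show ?case by simp
  next
    case (8 x y)
    with Z2_D(10)[OF 1 8] Z2_D(10)[OF 2 8] show ?case by simp
  qed (auto simp: Z2_D(5-7)[OF 1] Z2_D(5-7)[OF 2] A.a_ac)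
qed

lemma Z2_minus_closed:
  assumes 1: "(f, g) \<in> Z2_set L A"
  shows "(\<lambda>p \<in> carrier L \<times> carrier L. \<ominus>\<^bsub>A\<^esub> f p, \<lambda>p \<in> carrier L \<times> carrier L. \<ominus>\<^bsub>A\<^esub> g p) \<in> Z2_set L A"
proof -
  note [simp] = Z2_D(3,4)[OF 1] L.bracket_closed
  show ?thesis
  proof (rule Z2_I, goal_cases)
    case (6 x y z)
    with arg_cong[OF Z2_D(8)[OF 1 6], of "a_inv A"] show ?case by (simp add: A.minus_add)
  next
    case (7 x y z)
    with arg_cong[OF Z2_D(9)[OF 1 7], of "a_inv A"] show ?case by (simp add: A.minus_add)
  next
    case (8 x y)
    with Z2_D(10)[OF 1 8] show ?case by simp
  qed (auto simp: Z2_D(5-7)[OF 1] A.minus_add)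
qed

text \<open>Coboundaries are the cocycles of the direct product for the sections x -> (t x, x),
  which explains why the conditions hold; here they are verified directly by telescoping.\<close>

lemma coboundary_closed:
  assumes t: "t \<in> carrier L \<rightarrow> carrier A" and t0: "t \<zero>\<^bsub>L\<^esub> = \<zero>\<^bsub>A\<^esub>"
  shows "coboundary L A t \<in> Z2_set L A"
proof -
  have [simp]: "x \<in> carrier L \<Longrightarrow> t x \<in> carrier A" for x
    using t by auto
  note [simp] = L.bracket_closed
  show ?thesis
    unfolding coboundary_def
  proof (rule Z2_I, goal_cases)
    case (3 x y z)
    have "\<ominus>\<^bsub>A\<^esub> c = (\<ominus>\<^bsub>A\<^esub> a) \<oplus>\<^bsub>A\<^esub> (\<ominus>\<^bsub>A\<^esub> b) \<oplus>\<^bsub>A\<^esub> (a \<oplus>\<^bsub>A\<^esub> b \<ominus>\<^bsub>A\<^esub> c)"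
      if "a \<in> carrier A" "b \<in> carrier A" "c \<in> carrier A" for a b c
      using that by algebra
    with 3 show ?case by (simp add: L.bracket_add_left)
  next
    case (4 x y z)
    have "\<ominus>\<^bsub>A\<^esub> c = (\<ominus>\<^bsub>A\<^esub> a) \<oplus>\<^bsub>A\<^esub> (\<ominus>\<^bsub>A\<^esub> b) \<oplus>\<^bsub>A\<^esub> (a \<oplus>\<^bsub>A\<^esub> b \<ominus>\<^bsub>A\<^esub> c)"
      if "a \<in> carrier A" "b \<in> carrier A" "c \<in> carrier A" for a b c
      using that by algebra
    with 4 show ?case by (simp add: L.bracket_add_right)
  next
    case (5 x)
    then show ?case by (simp add: L.bracket_self t0)
  next
    case (6 x y z)
    let ?u = "x \<otimes>\<^bsub>L\<^esub> (y \<otimes>\<^bsub>L\<^esub> z)" and ?v = "z \<otimes>\<^bsub>L\<^esub> (x \<otimes>\<^bsub>L\<^esub> y)" and ?w = "y \<otimes>\<^bsub>L\<^esub> (z \<otimes>\<^bsub>L\<^esub> x)"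
    have "?u \<oplus>\<^bsub>L\<^esub> ?v = \<ominus>\<^bsub>L\<^esub> ?w"
      by (rule L.bracket_cyclic[OF 6])
    \<comment> \<open>Here a, b, c are the values of t at \<open>?u\<close>, \<open>?v\<close>,
      \<open>?w\<close>, and d is its value at - \<open>?w\<close>, which is \<open>?u\<close> +
      \<open>?v\<close>. The closing zero is t (- \<open>?w\<close> + \<open>?w\<close>), where t 0
      = 0 enters.\<close>
    moreover have "(\<ominus>\<^bsub>A\<^esub> a) \<oplus>\<^bsub>A\<^esub> (\<ominus>\<^bsub>A\<^esub> b) \<oplus>\<^bsub>A\<^esub> (\<ominus>\<^bsub>A\<^esub> c) \<oplus>\<^bsub>A\<^esub>
        ((a \<oplus>\<^bsub>A\<^esub> b \<ominus>\<^bsub>A\<^esub> d) \<oplus>\<^bsub>A\<^esub> (d \<oplus>\<^bsub>A\<^esub> c \<ominus>\<^bsub>A\<^esub> \<zero>\<^bsub>A\<^esub>)) = \<zero>\<^bsub>A\<^esub>"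
      if "a \<in> carrier A" "b \<in> carrier A" "c \<in> carrier A" "d \<in> carrier A" for a b c d
      using that by algebra
    ultimately show ?case using 6 by (simp add: t0 L.l_neg)
  next
    case (7 x y z)
    \<comment> \<open>p, q, r are the values of t at x + y, x + y + z and y + z.\<close>
    have "(p \<oplus>\<^bsub>A\<^esub> c \<ominus>\<^bsub>A\<^esub> q) \<oplus>\<^bsub>A\<^esub> (a \<oplus>\<^bsub>A\<^esub> b \<ominus>\<^bsub>A\<^esub> p) = (a \<oplus>\<^bsub>A\<^esub> r \<ominus>\<^bsub>A\<^esub> q) \<oplus>\<^bsub>A\<^esub> (b \<oplus>\<^bsub>A\<^esub> c \<ominus>\<^bsub>A\<^esub> r)"
      if "a \<in> carrier A" "b \<in> carrier A" "c \<in> carrier A"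
        "p \<in> carrier A" "q \<in> carrier A" "r \<in> carrier A" for a b c p q r
      using that by algebra
    with 7 show ?case by (simp add: L.a_assoc)
  next
    case (8 x y)
    then show ?case by (simp add: L.a_comm[of x y] A.a_comm[of "t x" "t y"])
  qed auto
qed

lemma comm_group_Z2: "comm_group (Z2 L A)"
proof (rule comm_groupI)
  fix p q r assume "p \<in> carrier (Z2 L A)" "q \<in> carrier (Z2 L A)" "r \<in> carrier (Z2 L A)"
  then obtain f g f' g' f'' g'' where
    p: "p = (f, g)" "(f, g) \<in> Z2_set L A" and q: "q = (f', g')" "(f', g') \<in> Z2_set L A"
    and r: "r = (f'', g'')" "(f'', g'') \<in> Z2_set L A"
    by (metis carrier_Z2 surj_pair)
  show "p \<otimes>\<^bsub>Z2 L A\<^esub> q \<otimes>\<^bsub>Z2 L A\<^esub> r = p \<otimes>\<^bsub>Z2 L A\<^esub> (q \<otimes>\<^bsub>Z2 L A\<^esub> r)"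
    unfolding p(1) q(1) r(1) mult_Z2
    by (auto intro!: restrict_ext simp: A.a_assoc Z2_D(3,4)[OF p(2)] Z2_D(3,4)[OF q(2)] Z2_D(3,4)[OF r(2)])
next
  fix p q assume "p \<in> carrier (Z2 L A)" "q \<in> carrier (Z2 L A)"
  then obtain f g f' g' where
    p: "p = (f, g)" "(f, g) \<in> Z2_set L A" and q: "q = (f', g')" "(f', g') \<in> Z2_set L A"
    by (metis carrier_Z2 surj_pair)
  show "p \<otimes>\<^bsub>Z2 L A\<^esub> q \<in> carrier (Z2 L A)"
    unfolding p(1) q(1) carrier_Z2 using p(2) q(2) by (rule Z2_mult_closed)
  show "p \<otimes>\<^bsub>Z2 L A\<^esub> q = q \<otimes>\<^bsub>Z2 L A\<^esub> p"
    unfolding p(1) q(1) mult_Z2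
    by (auto intro!: restrict_ext simp: A.a_comm Z2_D(3,4)[OF p(2)] Z2_D(3,4)[OF q(2)])
next
  show "\<one>\<^bsub>Z2 L A\<^esub> \<in> carrier (Z2 L A)"
    unfolding one_Z2 carrier_Z2 by (rule Z2_I) (auto simp: L.bracket_closed)
next
  fix p assume "p \<in> carrier (Z2 L A)"
  then obtain f g where p: "p = (f, g)" "(f, g) \<in> Z2_set L A"
    by (metis carrier_Z2 surj_pair)
  \<comment> \<open>Products are restricted to the carrier, so the unit law holds literally because
    cocycles are extensional.\<close>
  have "(\<lambda>p \<in> carrier L \<times> carrier L. f p) = f" "(\<lambda>p \<in> carrier L \<times> carrier L. g p) = g"
    using Z2_D(1,2)[OF p(2)] by (auto simp: PiE_restrict)
  moreover have "f q \<in> carrier A" "g q \<in> carrier A" if "q \<in> carrier L \<times> carrier L" for q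
    using Z2_D(1,2)[OF p(2)] that by auto
  ultimately show "\<one>\<^bsub>Z2 L A\<^esub> \<otimes>\<^bsub>Z2 L A\<^esub> p = p"
    unfolding p(1) one_Z2 mult_Z2 by (simp cong: restrict_cong)
  show "\<exists>q\<in>carrier (Z2 L A). q \<otimes>\<^bsub>Z2 L A\<^esub> p = \<one>\<^bsub>Z2 L A\<^esub>"
    by (rule bexI[of _ "(\<lambda>p \<in> carrier L \<times> carrier L. \<ominus>\<^bsub>A\<^esub> f p, \<lambda>p \<in> carrier L \<times> carrier L. \<ominus>\<^bsub>A\<^esub> g p)"])
      (auto intro!: restrict_ext Z2_minus_closed simp: p one_Z2 mult_Z2 A.l_neg Z2_D(3,4)[OF p(2)])
qed

lemma coboundary_mult:
  assumes "t \<in> carrier L \<rightarrow> carrier A" "t' \<in> carrier L \<rightarrow> carrier A"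
  shows "coboundary L A t \<otimes>\<^bsub>Z2 L A\<^esub> coboundary L A t' = coboundary L A (\<lambda>x. t x \<oplus>\<^bsub>A\<^esub> t' x)"
proof -
  have [simp]: "t x \<in> carrier A" "t' x \<in> carrier A" if "x \<in> carrier L" for x
    using assms that by auto
  have *: "(a \<oplus>\<^bsub>A\<^esub> b \<ominus>\<^bsub>A\<^esub> c) \<oplus>\<^bsub>A\<^esub> (a' \<oplus>\<^bsub>A\<^esub> b' \<ominus>\<^bsub>A\<^esub> c') = (a \<oplus>\<^bsub>A\<^esub> a') \<oplus>\<^bsub>A\<^esub> (b \<oplus>\<^bsub>A\<^esub> b') \<ominus>\<^bsub>A\<^esub> (c \<oplus>\<^bsub>A\<^esub> c')"
    if "a \<in> carrier A" "b \<in> carrier A" "c \<in> carrier A" "a' \<in> carrier A" "b' \<in> carrier A" "c' \<in> carrier A"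
    for a b c a' b' c'
    using that by algebra
  show ?thesis
    unfolding coboundary_def mult_Z2
    by (auto intro!: restrict_ext simp: A.minus_add L.bracket_closed *)
qed

text \<open>The coboundary is additive in t, so inverses come from the pointwise negative of t and
  products from the pointwise sum.\<close>

lemma subgroup_B2: "subgroup (B2 L A) (Z2 L A)"
proof -
  interpret Z: comm_group "Z2 L A" by (rule comm_group_Z2)
  have one: "coboundary L A (\<lambda>x. \<zero>\<^bsub>A\<^esub>) = \<one>\<^bsub>Z2 L A\<^esub>"
    unfolding coboundary_def one_Z2 prod.inject
    by (auto simp: A.minus_eq intro!: restrict_ext)
  show ?thesis
  proof (rule Z.subgroupI)
    show "B2 L A \<subseteq> carrier (Z2 L A)"
      by (auto simp: B2_def coboundary_closed)
    have "coboundary L A (\<lambda>x. \<zero>\<^bsub>A\<^esub>) \<in> B2 L A"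
      unfolding B2_def by blast
    then show "B2 L A \<noteq> {}" by blast
  next
    fix a assume "a \<in> B2 L A"
    then obtain t where t: "a = coboundary L A t" "t \<in> carrier L \<rightarrow> carrier A" "t \<zero>\<^bsub>L\<^esub> = \<zero>\<^bsub>A\<^esub>"
      by (auto simp: B2_def)
    let ?t = "\<lambda>x. \<ominus>\<^bsub>A\<^esub> t x"
    have t': "?t \<in> carrier L \<rightarrow> carrier A" "?t \<zero>\<^bsub>L\<^esub> = \<zero>\<^bsub>A\<^esub>"
      using t by auto
    have "coboundary L A ?t \<otimes>\<^bsub>Z2 L A\<^esub> a = coboundary L A (\<lambda>x. ?t x \<oplus>\<^bsub>A\<^esub> t x)"
      unfolding t(1) by (rule coboundary_mult[OF t'(1) t(2)])
    also have "\<dots> = coboundary L A (\<lambda>x. \<zero>\<^bsub>A\<^esub>)"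
      using t(2) by (auto simp: coboundary_def A.l_neg L.bracket_closed Pi_iff intro!: restrict_ext)
    finally have "inv\<^bsub>Z2 L A\<^esub> a = coboundary L A ?t"
      unfolding one using t t' by (intro Z.inv_equality) (auto simp: coboundary_closed)
    with t' show "inv\<^bsub>Z2 L A\<^esub> a \<in> B2 L A"
      by (auto simp: B2_def)
  next
    fix a b assume "a \<in> B2 L A" "b \<in> B2 L A"
    then obtain t t' where "a = coboundary L A t" "t \<in> carrier L \<rightarrow> carrier A" "t \<zero>\<^bsub>L\<^esub> = \<zero>\<^bsub>A\<^esub>"
      "b = coboundary L A t'" "t' \<in> carrier L \<rightarrow> carrier A" "t' \<zero>\<^bsub>L\<^esub> = \<zero>\<^bsub>A\<^esub>"
      by (auto simp: B2_def)
    then show "a \<otimes>\<^bsub>Z2 L A\<^esub> b \<in> B2 L A"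
      by (auto simp: B2_def coboundary_mult intro!: exI[of _ "\<lambda>x. t x \<oplus>\<^bsub>A\<^esub> t' x"])
  qed
qed

end

text \<open>\<open>lie_hom\<close> does not mention zero; h 0 = h 0 + h 0 and cancellation force
  it.\<close>

lemma lie_hom_zero:
  assumes "lie_ring B" "lie_ring C" "h \<in> lie_hom B C"
  shows "h \<zero>\<^bsub>B\<^esub> = \<zero>\<^bsub>C\<^esub>"
proof -
  interpret B: lie_ring B by fact
  interpret C: lie_ring C by fact
  have "h \<zero>\<^bsub>B\<^esub> \<in> carrier C" "h (\<zero>\<^bsub>B\<^esub> \<oplus>\<^bsub>B\<^esub> \<zero>\<^bsub>B\<^esub>) = h \<zero>\<^bsub>B\<^esub> \<oplus>\<^bsub>C\<^esub> h \<zero>\<^bsub>B\<^esub>"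
    using assms(3) B.zero_closed unfolding lie_hom_def by blast+
  then show ?thesis
    by (metis B.l_zero B.zero_closed C.add.r_cancel_one')
qed

section \<open>Sections of a central extension and their cocycles\<close>

locale central_ext = lie_pair L A for L :: "'l ring" and A :: "'a ring" +
  fixes E :: "('a, 'b, 'l) extension"
  assumes ext: "central_extension L A E"
begin

abbreviation "B \<equiv> mid E"
abbreviation "i \<equiv> incl E"
abbreviation "p \<equiv> proj E"

sublocale B: lie_ring B
  using ext by (simp add: central_extension_def)

lemma i_closed [simp]: "a \<in> carrier A \<Longrightarrow> i a \<in> carrier B"
  and i_add: "\<lbrakk>a \<in> carrier A; a' \<in> carrier A\<rbrakk> \<Longrightarrow> i (a \<oplus>\<^bsub>A\<^esub> a') = i a \<oplus>\<^bsub>B\<^esub> i a'"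
  and p_closed [simp]: "b \<in> carrier B \<Longrightarrow> p b \<in> carrier L"
  and p_add [simp]: "\<lbrakk>b \<in> carrier B; b' \<in> carrier B\<rbrakk> \<Longrightarrow> p (b \<oplus>\<^bsub>B\<^esub> b') = p b \<oplus>\<^bsub>L\<^esub> p b'"
  and p_bracket [simp]:
    "\<lbrakk>b \<in> carrier B; b' \<in> carrier B\<rbrakk> \<Longrightarrow> p (b \<otimes>\<^bsub>B\<^esub> b') = p b \<otimes>\<^bsub>L\<^esub> p b'"
  and p_surj: "p ` carrier B = carrier L"
  and i_inject: "\<lbrakk>a \<in> carrier A; a' \<in> carrier A\<rbrakk> \<Longrightarrow> i a = i a' \<longleftrightarrow> a = a'"
  and i_image: "i ` carrier A = {b \<in> carrier B. p b = \<zero>\<^bsub>L\<^esub>}"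
  using ext by (auto simp: central_extension_def lie_hom_def inj_on_eq_iff a_kernel_def')

lemma i_zero [simp]: "i \<zero>\<^bsub>A\<^esub> = \<zero>\<^bsub>B\<^esub>"
  using ext A.lie_ring_axioms B.lie_ring_axioms
  by (intro lie_hom_zero) (auto simp: central_extension_def)

lemma p_i [simp]: "a \<in> carrier A \<Longrightarrow> p (i a) = \<zero>\<^bsub>L\<^esub>"
  using i_image by auto

lemma p_minus:
  assumes "b \<in> carrier B"
  shows "p (\<ominus>\<^bsub>B\<^esub> b) = \<ominus>\<^bsub>L\<^esub> p b"
proof -
  have "p (\<ominus>\<^bsub>B\<^esub> b) \<oplus>\<^bsub>L\<^esub> p b = p \<zero>\<^bsub>B\<^esub>"
    using assms by (simp flip: p_add add: B.l_neg)
  also have "\<dots> = \<zero>\<^bsub>L\<^esub>"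
    using p_i[of "\<zero>\<^bsub>A\<^esub>"] by simp
  finally show ?thesis
    using assms by (simp add: L.minus_equality)
qed

lemma i_bracket [simp]:
  assumes "a \<in> carrier A" "b \<in> carrier B"
  shows "i a \<otimes>\<^bsub>B\<^esub> b = \<zero>\<^bsub>B\<^esub>" "b \<otimes>\<^bsub>B\<^esub> i a = \<zero>\<^bsub>B\<^esub>"
proof -
  have "i a \<in> lie_center B"
    using ext assms(1) by (auto simp: central_extension_def)
  then show "i a \<otimes>\<^bsub>B\<^esub> b = \<zero>\<^bsub>B\<^esub>" "b \<otimes>\<^bsub>B\<^esub> i a = \<zero>\<^bsub>B\<^esub>"
    using lie_center_bracket[OF B.lie_ring_axioms] assms(2) by auto
qed

text \<open>Closing step for each cocycle condition: an element of B is computed in two ways with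
  the same section value as second summand, and the coordinates in A must agree.\<close>

lemma i_cancel:
  assumes "i a \<oplus>\<^bsub>B\<^esub> b = i a' \<oplus>\<^bsub>B\<^esub> b" "a \<in> carrier A" "a' \<in> carrier A" "b \<in> carrier B"
  shows "a = a'"
  using assms by (simp add: i_inject)

text \<open>Exactness at B: elements over the same point of L differ by an element of the kernel,
  which is the image of A. With c a section value, a is the A-coordinate of b.\<close>

lemma fibre:
  assumes "b \<in> carrier B" "c \<in> carrier B" "p b = p c"
  obtains a where "a \<in> carrier A" "b = i a \<oplus>\<^bsub>B\<^esub> c"
proof -
  have "p (b \<ominus>\<^bsub>B\<^esub> c) = \<zero>\<^bsub>L\<^esub>"
    using assms by (simp add: B.minus_eq p_minus L.r_neg)
  then have "b \<ominus>\<^bsub>B\<^esub> c \<in> i ` carrier A"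
    using assms by (simp add: i_image)
  then obtain a where a: "a \<in> carrier A" "i a = b \<ominus>\<^bsub>B\<^esub> c" by auto
  have "b = (b \<ominus>\<^bsub>B\<^esub> c) \<oplus>\<^bsub>B\<^esub> c"
    using assms by algebra
  with a that show thesis by metis
qed

definition normalised :: "('l \<Rightarrow> 'b) \<Rightarrow> bool" where
  "normalised s \<longleftrightarrow> s \<in> sections L E \<and> s \<zero>\<^bsub>L\<^esub> = \<zero>\<^bsub>B\<^esub>"

text \<open>The data of \<open>section_cocycle\<close> without inverse and subtraction: f and g are
  characterised by equations that homomorphisms preserve. \<open>section_cocycle_eqI\<close> and
  \<open>represents_section_cocycle\<close> connect the two descriptions.\<close>

definition represents :: "('l \<Rightarrow> 'b) \<Rightarrow> ('l \<times> 'l \<Rightarrow> 'a) \<Rightarrow> ('l \<times> 'l \<Rightarrow> 'a) \<Rightarrow> bool" where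
  "represents s f g \<longleftrightarrow>
     f \<in> carrier L \<times> carrier L \<rightarrow>\<^sub>E carrier A \<and> g \<in> carrier L \<times> carrier L \<rightarrow>\<^sub>E carrier A \<and>
     (\<forall>x\<in>carrier L. \<forall>y\<in>carrier L.
        s x \<otimes>\<^bsub>B\<^esub> s y = i (f (x, y)) \<oplus>\<^bsub>B\<^esub> s (x \<otimes>\<^bsub>L\<^esub> y) \<and>
        s x \<oplus>\<^bsub>B\<^esub> s y = i (g (x, y)) \<oplus>\<^bsub>B\<^esub> s (x \<oplus>\<^bsub>L\<^esub> y))"

lemma section_closed: "\<lbrakk>s \<in> sections L E; x \<in> carrier L\<rbrakk> \<Longrightarrow> s x \<in> carrier B"
  and p_section: "\<lbrakk>s \<in> sections L E; x \<in> carrier L\<rbrakk> \<Longrightarrow> p (s x) = x"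
  by (auto simp: sections_def)

lemma ex_normalised: "\<exists>s. normalised s"
proof -
  \<comment> \<open>The update at zero normalises the section and keeps it a section, since p maps
    zero to zero.\<close>
  define s where "s = (inv_into (carrier B) p)(\<zero>\<^bsub>L\<^esub> := \<zero>\<^bsub>B\<^esub>)"
  have "p \<zero>\<^bsub>B\<^esub> = \<zero>\<^bsub>L\<^esub>" using p_i[of "\<zero>\<^bsub>A\<^esub>"] by simp
  then have "normalised s"
    unfolding normalised_def s_def sections_def
    using p_surj by (auto simp: f_inv_into_f inv_into_into)
  then show ?thesis by blast
qed

lemma inv_into_diff:
  assumes "b = i a \<oplus>\<^bsub>B\<^esub> c" "a \<in> carrier A" "c \<in> carrier B"
  shows "inv_into (carrier A) i (b \<ominus>\<^bsub>B\<^esub> c) = a"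
proof -
  have "i a \<oplus>\<^bsub>B\<^esub> c \<ominus>\<^bsub>B\<^esub> c = i a"
    using i_closed[OF assms(2)] assms(3) by algebra
  with assms ext show ?thesis by (simp add: inv_into_f_f central_extension_def)
qed

lemma inv_into_diff_eq:
  assumes "b \<in> carrier B" "c \<in> carrier B" "p b = p c"
  shows "inv_into (carrier A) i (b \<ominus>\<^bsub>B\<^esub> c) \<in> carrier A"
    and "b = i (inv_into (carrier A) i (b \<ominus>\<^bsub>B\<^esub> c)) \<oplus>\<^bsub>B\<^esub> c"
proof -
  obtain a where "a \<in> carrier A" "b = i a \<oplus>\<^bsub>B\<^esub> c"
    using fibre[OF assms] .
  with inv_into_diff[OF this(2,1)] assms
  show "inv_into (carrier A) i (b \<ominus>\<^bsub>B\<^esub> c) \<in> carrier A"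
    and "b = i (inv_into (carrier A) i (b \<ominus>\<^bsub>B\<^esub> c)) \<oplus>\<^bsub>B\<^esub> c"
    by simp_all
qed

lemma section_cocycle_eqI:
  assumes s: "s \<in> sections L E" and r: "represents s f g"
  shows "section_cocycle L A E s = (f, g)"
proof -
  note c = section_closed[OF s] B.bracket_closed L.bracket_closed
  have f: "f \<in> carrier L \<times> carrier L \<rightarrow>\<^sub>E carrier A" and g: "g \<in> carrier L \<times> carrier L \<rightarrow>\<^sub>E carrier A"
    using r by (auto simp: represents_def)
  have "inv_into (carrier A) i ((s x \<otimes>\<^bsub>B\<^esub> s y) \<ominus>\<^bsub>B\<^esub> s (x \<otimes>\<^bsub>L\<^esub> y)) = f (x, y)"
    "inv_into (carrier A) i ((s x \<oplus>\<^bsub>B\<^esub> s y) \<ominus>\<^bsub>B\<^esub> s (x \<oplus>\<^bsub>L\<^esub> y)) = g (x, y)"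
    if "x \<in> carrier L" "y \<in> carrier L" for x y
    using r that f g by (auto simp: represents_def c intro!: inv_into_diff)
  then have "section_cocycle L A E s = (restrict f (carrier L \<times> carrier L), restrict g (carrier L \<times> carrier L))"
    unfolding section_cocycle_def by (auto intro!: restrict_ext)
  with f g show ?thesis by (simp add: PiE_restrict)
qed

lemma represents_section_cocycle:
  assumes s: "s \<in> sections L E"
  obtains f g where "represents s f g" "section_cocycle L A E s = (f, g)"
proof -
  note c = section_closed[OF s] p_section[OF s] B.bracket_closed L.bracket_closed
  have "represents s (fst (section_cocycle L A E s)) (snd (section_cocycle L A E s))"
    unfolding represents_def section_cocycle_def fst_conv snd_conv
  proof (intro conjI ballI)
    fix x y assume "x \<in> carrier L" "y \<in> carrier L"
    then show "s x \<otimes>\<^bsub>B\<^esub> s y = i ((\<lambda>(x, y) \<in> carrier L \<times> carrier L. inv_into (carrier A) i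
        ((s x \<otimes>\<^bsub>B\<^esub> s y) \<ominus>\<^bsub>B\<^esub> s (x \<otimes>\<^bsub>L\<^esub> y))) (x, y)) \<oplus>\<^bsub>B\<^esub> s (x \<otimes>\<^bsub>L\<^esub> y)"
      and "s x \<oplus>\<^bsub>B\<^esub> s y = i ((\<lambda>(x, y) \<in> carrier L \<times> carrier L. inv_into (carrier A) i
        ((s x \<oplus>\<^bsub>B\<^esub> s y) \<ominus>\<^bsub>B\<^esub> s (x \<oplus>\<^bsub>L\<^esub> y))) (x, y)) \<oplus>\<^bsub>B\<^esub> s (x \<oplus>\<^bsub>L\<^esub> y)"
      using inv_into_diff_eq(2)[of "s x \<otimes>\<^bsub>B\<^esub> s y" "s (x \<otimes>\<^bsub>L\<^esub> y)"]
        inv_into_diff_eq(2)[of "s x \<oplus>\<^bsub>B\<^esub> s y" "s (x \<oplus>\<^bsub>L\<^esub> y)"]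
      by (simp_all add: c)
  qed (auto intro!: inv_into_diff_eq(1) simp: c)
  then show thesis
    using that by simp
qed

text \<open>Each condition is one law of B for section values, with both sides brought to the form i
  a + s x. Distributivity gives the additivity laws of f, [b, b] = 0 the alternating law, Jacobi the
  cyclic one, and associativity and commutativity of addition the two laws of g.\<close>

lemma represents_in_Z2:
  assumes n: "normalised s" and r: "represents s f g"
  shows "(f, g) \<in> Z2_set L A"
proof -
  have s: "s \<in> sections L E" and s0: "s \<zero>\<^bsub>L\<^esub> = \<zero>\<^bsub>B\<^esub>"
    using n by (auto simp: normalised_def)
  have f: "f \<in> carrier L \<times> carrier L \<rightarrow>\<^sub>E carrier A" and g: "g \<in> carrier L \<times> carrier L \<rightarrow>\<^sub>E carrier A"
    and br: "\<And>x y. \<lbrakk>x \<in> carrier L; y \<in> carrier L\<rbrakk> \<Longrightarrow>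
      s x \<otimes>\<^bsub>B\<^esub> s y = i (f (x, y)) \<oplus>\<^bsub>B\<^esub> s (x \<otimes>\<^bsub>L\<^esub> y)"
    and add: "\<And>x y. \<lbrakk>x \<in> carrier L; y \<in> carrier L\<rbrakk> \<Longrightarrow>
      s x \<oplus>\<^bsub>B\<^esub> s y = i (g (x, y)) \<oplus>\<^bsub>B\<^esub> s (x \<oplus>\<^bsub>L\<^esub> y)"
    using r by (auto simp: represents_def)
  have [simp]: "f (x, y) \<in> carrier A" "g (x, y) \<in> carrier A"
    if "x \<in> carrier L" "y \<in> carrier L" for x y
    using f g that by auto
  note [simp] = section_closed[OF s] B.bracket_closed L.bracket_closed
  show ?thesis
  proof (rule Z2_I[OF f g], goal_cases)
    case (1 x y z)
    have "i (f (x \<oplus>\<^bsub>L\<^esub> y, z)) \<oplus>\<^bsub>B\<^esub> s (x \<otimes>\<^bsub>L\<^esub> z \<oplus>\<^bsub>L\<^esub> y \<otimes>\<^bsub>L\<^esub> z) = s (x \<oplus>\<^bsub>L\<^esub> y) \<otimes>\<^bsub>B\<^esub> s z"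
      using 1 by (simp add: br L.bracket_add_left)
    \<comment> \<open>The elements s (x + y) and s x + s y differ by the central i (g (x, y)), so
      the bracket with s z does not distinguish them.\<close>
    also have "\<dots> = (s x \<oplus>\<^bsub>B\<^esub> s y) \<otimes>\<^bsub>B\<^esub> s z"
      using 1 by (simp add: add B.bracket_add_left)
    also have "\<dots> = (s x \<otimes>\<^bsub>B\<^esub> s z) \<oplus>\<^bsub>B\<^esub> (s y \<otimes>\<^bsub>B\<^esub> s z)"
      using 1 by (simp add: B.bracket_add_left)
    also have "\<dots> = i (f (x, z)) \<oplus>\<^bsub>B\<^esub> i (f (y, z)) \<oplus>\<^bsub>B\<^esub> (s (x \<otimes>\<^bsub>L\<^esub> z) \<oplus>\<^bsub>B\<^esub> s (y \<otimes>\<^bsub>L\<^esub> z))"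
      using 1 by (simp add: br B.a_ac)
    also have "\<dots> = i (f (x, z) \<oplus>\<^bsub>A\<^esub> f (y, z) \<oplus>\<^bsub>A\<^esub> g (x \<otimes>\<^bsub>L\<^esub> z, y \<otimes>\<^bsub>L\<^esub> z)) \<oplus>\<^bsub>B\<^esub>
        s (x \<otimes>\<^bsub>L\<^esub> z \<oplus>\<^bsub>L\<^esub> y \<otimes>\<^bsub>L\<^esub> z)"
      using 1 by (simp add: add i_add B.a_assoc)
    finally show ?case
      by (rule i_cancel) (use 1 in simp_all)
  next
    case (2 x y z)
    have "i (f (x, y \<oplus>\<^bsub>L\<^esub> z)) \<oplus>\<^bsub>B\<^esub> s (x \<otimes>\<^bsub>L\<^esub> y \<oplus>\<^bsub>L\<^esub> x \<otimes>\<^bsub>L\<^esub> z) = s x \<otimes>\<^bsub>B\<^esub> s (y \<oplus>\<^bsub>L\<^esub> z)"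
      using 2 by (simp add: br L.bracket_add_right)
    also have "\<dots> = s x \<otimes>\<^bsub>B\<^esub> (s y \<oplus>\<^bsub>B\<^esub> s z)"
      using 2 by (simp add: add B.bracket_add_right)
    also have "\<dots> = (s x \<otimes>\<^bsub>B\<^esub> s y) \<oplus>\<^bsub>B\<^esub> (s x \<otimes>\<^bsub>B\<^esub> s z)"
      using 2 by (simp add: B.bracket_add_right)
    also have "\<dots> = i (f (x, y)) \<oplus>\<^bsub>B\<^esub> i (f (x, z)) \<oplus>\<^bsub>B\<^esub> (s (x \<otimes>\<^bsub>L\<^esub> y) \<oplus>\<^bsub>B\<^esub> s (x \<otimes>\<^bsub>L\<^esub> z))"
      using 2 by (simp add: br B.a_ac)
    also have "\<dots> = i (f (x, y) \<oplus>\<^bsub>A\<^esub> f (x, z) \<oplus>\<^bsub>A\<^esub> g (x \<otimes>\<^bsub>L\<^esub> y, x \<otimes>\<^bsub>L\<^esub> z)) \<oplus>\<^bsub>B\<^esub>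
        s (x \<otimes>\<^bsub>L\<^esub> y \<oplus>\<^bsub>L\<^esub> x \<otimes>\<^bsub>L\<^esub> z)"
      using 2 by (simp add: add i_add B.a_assoc)
    finally show ?case
      by (rule i_cancel) (use 2 in simp_all)
  next
    case (3 x)
    \<comment> \<open>The section value s [x, x] is s 0, which vanishes by normalisation.\<close>
    have "i (f (x, x)) \<oplus>\<^bsub>B\<^esub> \<zero>\<^bsub>B\<^esub> = i \<zero>\<^bsub>A\<^esub> \<oplus>\<^bsub>B\<^esub> \<zero>\<^bsub>B\<^esub>"
      using br[OF 3 3] 3 by (simp add: L.bracket_self B.bracket_self s0)
    then show ?case
      by (rule i_cancel) (use 3 in simp_all)
  next
    case (4 x y z)
    let ?u = "x \<otimes>\<^bsub>L\<^esub> (y \<otimes>\<^bsub>L\<^esub> z)" and ?v = "z \<otimes>\<^bsub>L\<^esub> (x \<otimes>\<^bsub>L\<^esub> y)" and ?w = "y \<otimes>\<^bsub>L\<^esub> (z \<otimes>\<^bsub>L\<^esub> x)"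
    \<comment> \<open>The inner error term i (f (b, c)) is central and disappears under the outer
      bracket, so one value of f survives.\<close>
    have nested: "s a \<otimes>\<^bsub>B\<^esub> (s b \<otimes>\<^bsub>B\<^esub> s c) = i (f (a, b \<otimes>\<^bsub>L\<^esub> c)) \<oplus>\<^bsub>B\<^esub> s (a \<otimes>\<^bsub>L\<^esub> (b \<otimes>\<^bsub>L\<^esub> c))"
      if "a \<in> carrier L" "b \<in> carrier L" "c \<in> carrier L" for a b c
    proof -
      have "s a \<otimes>\<^bsub>B\<^esub> (s b \<otimes>\<^bsub>B\<^esub> s c) = s a \<otimes>\<^bsub>B\<^esub> s (b \<otimes>\<^bsub>L\<^esub> c)"
        using that by (simp add: br[of b c] B.bracket_add_right)
      then show ?thesis using that by (simp add: br)
    qed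
    have "\<zero>\<^bsub>B\<^esub> = (s x \<otimes>\<^bsub>B\<^esub> (s y \<otimes>\<^bsub>B\<^esub> s z)) \<oplus>\<^bsub>B\<^esub> (s z \<otimes>\<^bsub>B\<^esub> (s x \<otimes>\<^bsub>B\<^esub> s y)) \<oplus>\<^bsub>B\<^esub> (s y \<otimes>\<^bsub>B\<^esub> (s z \<otimes>\<^bsub>B\<^esub> s x))"
      using 4 B.jacobi[of "s x" "s y" "s z"] by (simp add: B.a_ac)
    also have "\<dots> = i (f (x, y \<otimes>\<^bsub>L\<^esub> z)) \<oplus>\<^bsub>B\<^esub> i (f (z, x \<otimes>\<^bsub>L\<^esub> y)) \<oplus>\<^bsub>B\<^esub> i (f (y, z \<otimes>\<^bsub>L\<^esub> x)) \<oplus>\<^bsub>B\<^esub>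
        ((s ?u \<oplus>\<^bsub>B\<^esub> s ?v) \<oplus>\<^bsub>B\<^esub> s ?w)"
      using 4 by (simp add: nested B.a_ac)
    \<comment> \<open>In L the sum of \<open>?u\<close> and \<open>?v\<close> is -
      \<open>?w\<close>. Adding section values in this order produces the two g terms, and what is
      left at the end is s 0 = 0.\<close>
    also have "s ?u \<oplus>\<^bsub>B\<^esub> s ?v = i (g (?u, ?v)) \<oplus>\<^bsub>B\<^esub> s (\<ominus>\<^bsub>L\<^esub> ?w)"
      using 4 by (simp add: add L.bracket_cyclic)
    also have "\<dots> \<oplus>\<^bsub>B\<^esub> s ?w = i (g (?u, ?v)) \<oplus>\<^bsub>B\<^esub> (s (\<ominus>\<^bsub>L\<^esub> ?w) \<oplus>\<^bsub>B\<^esub> s ?w)"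
      using 4 by (simp add: B.a_assoc)
    also have "s (\<ominus>\<^bsub>L\<^esub> ?w) \<oplus>\<^bsub>B\<^esub> s ?w = i (g (\<ominus>\<^bsub>L\<^esub> ?w, ?w))"
      using 4 by (simp add: add L.l_neg s0)
    finally have "i ((f (x, y \<otimes>\<^bsub>L\<^esub> z) \<oplus>\<^bsub>A\<^esub> f (z, x \<otimes>\<^bsub>L\<^esub> y) \<oplus>\<^bsub>A\<^esub> f (y, z \<otimes>\<^bsub>L\<^esub> x)) \<oplus>\<^bsub>A\<^esub>
        (g (?u, ?v) \<oplus>\<^bsub>A\<^esub> g (\<ominus>\<^bsub>L\<^esub> ?w, ?w))) \<oplus>\<^bsub>B\<^esub> \<zero>\<^bsub>B\<^esub> = i \<zero>\<^bsub>A\<^esub> \<oplus>\<^bsub>B\<^esub> \<zero>\<^bsub>B\<^esub>"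
      using 4 by (simp add: i_add)
    then show ?case
      by (rule i_cancel) (use 4 in simp_all)
  next
    case (5 x y z)
    have "i (g (x \<oplus>\<^bsub>L\<^esub> y, z) \<oplus>\<^bsub>A\<^esub> g (x, y)) \<oplus>\<^bsub>B\<^esub> s (x \<oplus>\<^bsub>L\<^esub> y \<oplus>\<^bsub>L\<^esub> z) =
        i (g (x, y)) \<oplus>\<^bsub>B\<^esub> (s (x \<oplus>\<^bsub>L\<^esub> y) \<oplus>\<^bsub>B\<^esub> s z)"
      using 5 by (simp add: add i_add) (simp add: B.a_ac)
    also have "\<dots> = (s x \<oplus>\<^bsub>B\<^esub> s y) \<oplus>\<^bsub>B\<^esub> s z"
      using 5 by (simp add: add B.a_assoc)
    also have "\<dots> = s x \<oplus>\<^bsub>B\<^esub> (s y \<oplus>\<^bsub>B\<^esub> s z)"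
      using 5 by (simp add: B.a_assoc)
    also have "\<dots> = i (g (y, z)) \<oplus>\<^bsub>B\<^esub> (s x \<oplus>\<^bsub>B\<^esub> s (y \<oplus>\<^bsub>L\<^esub> z))"
      using 5 by (simp add: add[of y z] B.a_lcomm)
    also have "\<dots> = i (g (x, y \<oplus>\<^bsub>L\<^esub> z) \<oplus>\<^bsub>A\<^esub> g (y, z)) \<oplus>\<^bsub>B\<^esub> s (x \<oplus>\<^bsub>L\<^esub> y \<oplus>\<^bsub>L\<^esub> z)"
      using 5 by (simp add: add i_add L.a_assoc) (simp add: B.a_ac)
    finally show ?case
      by (rule i_cancel) (use 5 in simp_all)
  next
    case (6 x y)
    have "i (g (x, y)) \<oplus>\<^bsub>B\<^esub> s (x \<oplus>\<^bsub>L\<^esub> y) = i (g (y, x)) \<oplus>\<^bsub>B\<^esub> s (x \<oplus>\<^bsub>L\<^esub> y)"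
      using 6 add[of x y] add[of y x] by (simp add: B.a_comm L.a_comm)
    then show ?case
      by (rule i_cancel) (use 6 in simp_all)
  qed
qed

lemma section_cocycle_in_Z2:
  assumes "normalised s"
  shows "section_cocycle L A E s \<in> carrier (Z2 L A)"
proof -
  have "s \<in> sections L E" using assms by (simp add: normalised_def)
  then show ?thesis
    using represents_in_Z2[OF assms] by (metis carrier_Z2 represents_section_cocycle)
qed

text \<open>The shift i (t x) is central, so brackets of the new values equal those of the old ones,
  and f changes only because s [x, y] is rewritten as s' [x, y] - i (t [x, y]). A sum keeps the
  shifts at x and y and gives back the one at x + y. As t is arbitrary, this serves both to compare
  two sections and to realise a prescribed coboundary.\<close>

lemma represents_shift:
  assumes n: "normalised s" and r: "represents s f g"
    and t: "t \<in> carrier L \<rightarrow> carrier A" "t \<zero>\<^bsub>L\<^esub> = \<zero>\<^bsub>A\<^esub>"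
    and s': "\<And>x. x \<in> carrier L \<Longrightarrow> s' x = i (t x) \<oplus>\<^bsub>B\<^esub> s x"
  shows "normalised s'"
    and "section_cocycle L A E s' = coboundary L A t \<otimes>\<^bsub>Z2 L A\<^esub> (f, g)"
proof -
  have s: "s \<in> sections L E" and s0: "s \<zero>\<^bsub>L\<^esub> = \<zero>\<^bsub>B\<^esub>"
    using n by (auto simp: normalised_def)
  have [simp]: "x \<in> carrier L \<Longrightarrow> t x \<in> carrier A" for x
    using t by auto
  note [simp] = section_closed[OF s] p_section[OF s] B.bracket_closed L.bracket_closed
  have s's: "s' \<in> sections L E"
    by (auto simp: sections_def s')
  then show "normalised s'"
    by (simp add: normalised_def s' s0 t)
  have fg: "f (x, y) \<in> carrier A" "g (x, y) \<in> carrier A"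
    "s x \<otimes>\<^bsub>B\<^esub> s y = i (f (x, y)) \<oplus>\<^bsub>B\<^esub> s (x \<otimes>\<^bsub>L\<^esub> y)"
    "s x \<oplus>\<^bsub>B\<^esub> s y = i (g (x, y)) \<oplus>\<^bsub>B\<^esub> s (x \<oplus>\<^bsub>L\<^esub> y)" if "x \<in> carrier L" "y \<in> carrier L" for x y
    using r that by (auto simp: represents_def)
  \<comment> \<open>Both equations insert a t term and its negative, so that the right side ends in
    a value of s'.\<close>
  have sh: "i (f (x, y)) \<oplus>\<^bsub>B\<^esub> s (x \<otimes>\<^bsub>L\<^esub> y) =
      i ((\<ominus>\<^bsub>A\<^esub> t (x \<otimes>\<^bsub>L\<^esub> y)) \<oplus>\<^bsub>A\<^esub> f (x, y)) \<oplus>\<^bsub>B\<^esub> (i (t (x \<otimes>\<^bsub>L\<^esub> y)) \<oplus>\<^bsub>B\<^esub> s (x \<otimes>\<^bsub>L\<^esub> y))"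
    "i (t x) \<oplus>\<^bsub>B\<^esub> s x \<oplus>\<^bsub>B\<^esub> (i (t y) \<oplus>\<^bsub>B\<^esub> s y) =
      i ((t x \<oplus>\<^bsub>A\<^esub> t y \<ominus>\<^bsub>A\<^esub> t (x \<oplus>\<^bsub>L\<^esub> y)) \<oplus>\<^bsub>A\<^esub> g (x, y)) \<oplus>\<^bsub>B\<^esub> (i (t (x \<oplus>\<^bsub>L\<^esub> y)) \<oplus>\<^bsub>B\<^esub> s (x \<oplus>\<^bsub>L\<^esub> y))"
    if xy: "x \<in> carrier L" "y \<in> carrier L" for x y
  proof -
    have "((\<ominus>\<^bsub>A\<^esub> b) \<oplus>\<^bsub>A\<^esub> a) \<oplus>\<^bsub>A\<^esub> b = a" if "a \<in> carrier A" "b \<in> carrier A" for a b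
      using that by algebra
    from arg_cong[OF this, of "f (x, y)" "t (x \<otimes>\<^bsub>L\<^esub> y)" i] xy
    show "i (f (x, y)) \<oplus>\<^bsub>B\<^esub> s (x \<otimes>\<^bsub>L\<^esub> y) =
      i ((\<ominus>\<^bsub>A\<^esub> t (x \<otimes>\<^bsub>L\<^esub> y)) \<oplus>\<^bsub>A\<^esub> f (x, y)) \<oplus>\<^bsub>B\<^esub> (i (t (x \<otimes>\<^bsub>L\<^esub> y)) \<oplus>\<^bsub>B\<^esub> s (x \<otimes>\<^bsub>L\<^esub> y))"
      by (simp add: fg B.a_assoc[symmetric] flip: i_add)
    have "(a \<oplus>\<^bsub>A\<^esub> b \<ominus>\<^bsub>A\<^esub> c) \<oplus>\<^bsub>A\<^esub> d \<oplus>\<^bsub>A\<^esub> c = a \<oplus>\<^bsub>A\<^esub> b \<oplus>\<^bsub>A\<^esub> d"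
      if "a \<in> carrier A" "b \<in> carrier A" "c \<in> carrier A" "d \<in> carrier A" for a b c d
      using that by algebra
    note e = arg_cong[OF this, of "t x" "t y" "t (x \<oplus>\<^bsub>L\<^esub> y)" "g (x, y)" i]
    have "i (t x) \<oplus>\<^bsub>B\<^esub> s x \<oplus>\<^bsub>B\<^esub> (i (t y) \<oplus>\<^bsub>B\<^esub> s y) = i (t x) \<oplus>\<^bsub>B\<^esub> i (t y) \<oplus>\<^bsub>B\<^esub> (s x \<oplus>\<^bsub>B\<^esub> s y)"
      using xy by (simp add: B.a_ac)
    also have "\<dots> = i (t x \<oplus>\<^bsub>A\<^esub> t y \<oplus>\<^bsub>A\<^esub> g (x, y)) \<oplus>\<^bsub>B\<^esub> s (x \<oplus>\<^bsub>L\<^esub> y)"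
      using xy by (simp add: fg i_add B.a_assoc)
    also have "\<dots> = i ((t x \<oplus>\<^bsub>A\<^esub> t y \<ominus>\<^bsub>A\<^esub> t (x \<oplus>\<^bsub>L\<^esub> y)) \<oplus>\<^bsub>A\<^esub> g (x, y)) \<oplus>\<^bsub>B\<^esub>
        (i (t (x \<oplus>\<^bsub>L\<^esub> y)) \<oplus>\<^bsub>B\<^esub> s (x \<oplus>\<^bsub>L\<^esub> y))"
      using xy e by (simp add: fg B.a_assoc[symmetric] flip: i_add)
    finally show "i (t x) \<oplus>\<^bsub>B\<^esub> s x \<oplus>\<^bsub>B\<^esub> (i (t y) \<oplus>\<^bsub>B\<^esub> s y) = \<dots>" .
  qed
  show "section_cocycle L A E s' = coboundary L A t \<otimes>\<^bsub>Z2 L A\<^esub> (f, g)"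
    unfolding coboundary_def mult_Z2
    by (rule section_cocycle_eqI[OF s's])
      (auto simp: represents_def s' fg B.bracket_add_left B.bracket_add_right sh(2) simp flip: sh(1))
qed

text \<open>By exactness two sections differ by a map t into A, with t 0 = 0 because both are
  normalised; their cocycles then differ by the coboundary of t.\<close>

lemma section_cocycle_coset_eq:
  assumes n: "normalised s" and n': "normalised s'"
  shows "B2 L A #>\<^bsub>Z2 L A\<^esub> section_cocycle L A E s' = B2 L A #>\<^bsub>Z2 L A\<^esub> section_cocycle L A E s"
proof -
  interpret Z: comm_group "Z2 L A" by (rule comm_group_Z2)
  have s: "s \<in> sections L E" "s' \<in> sections L E" and s0: "s \<zero>\<^bsub>L\<^esub> = \<zero>\<^bsub>B\<^esub>" "s' \<zero>\<^bsub>L\<^esub> = \<zero>\<^bsub>B\<^esub>"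
    using n n' by (auto simp: normalised_def)
  note c = section_closed[OF s(1)] section_closed[OF s(2)] p_section[OF s(1)] p_section[OF s(2)]
  define t where "t x = inv_into (carrier A) i (s' x \<ominus>\<^bsub>B\<^esub> s x)" for x
  have t: "t \<in> carrier L \<rightarrow> carrier A" and s't: "\<And>x. x \<in> carrier L \<Longrightarrow> s' x = i (t x) \<oplus>\<^bsub>B\<^esub> s x"
    unfolding t_def using inv_into_diff_eq c by auto
  have t0: "t \<zero>\<^bsub>L\<^esub> = \<zero>\<^bsub>A\<^esub>"
    unfolding t_def s0 by (rule inv_into_diff) simp_all
  obtain f g where fg: "represents s f g" "section_cocycle L A E s = (f, g)"
    using represents_section_cocycle[OF s(1)] .
  have "section_cocycle L A E s' = coboundary L A t \<otimes>\<^bsub>Z2 L A\<^esub> section_cocycle L A E s"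
    unfolding fg(2) by (rule represents_shift(2)[OF n fg(1) t t0 s't])
  moreover have "coboundary L A t \<in> B2 L A"
    using t t0 by (auto simp: B2_def)
  ultimately have "section_cocycle L A E s' \<in> B2 L A #>\<^bsub>Z2 L A\<^esub> section_cocycle L A E s"
    by (auto simp: r_coset_def)
  then show ?thesis
    using Z.repr_independence section_cocycle_in_Z2[OF n] subgroup_B2 by blast
qed

text \<open>Removes the definite description for good: from here on any normalised section computes
  the class.\<close>

lemma ext_class_eq:
  assumes "normalised s"
  shows "ext_class L A E = B2 L A #>\<^bsub>Z2 L A\<^esub> section_cocycle L A E s"
  unfolding ext_class_def
proof (rule the_equality)
  show "\<exists>s'\<in>sections L E. s' \<zero>\<^bsub>L\<^esub> = \<zero>\<^bsub>B\<^esub> \<and>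
      B2 L A #>\<^bsub>Z2 L A\<^esub> section_cocycle L A E s = B2 L A #>\<^bsub>Z2 L A\<^esub> section_cocycle L A E s'"
    using assms unfolding normalised_def by blast
next
  fix c assume "\<exists>s'\<in>sections L E. s' \<zero>\<^bsub>L\<^esub> = \<zero>\<^bsub>B\<^esub> \<and>
      c = B2 L A #>\<^bsub>Z2 L A\<^esub> section_cocycle L A E s'"
  then obtain s' where "normalised s'" "c = B2 L A #>\<^bsub>Z2 L A\<^esub> section_cocycle L A E s'"
    unfolding normalised_def by blast
  then show "c = B2 L A #>\<^bsub>Z2 L A\<^esub> section_cocycle L A E s"
    using section_cocycle_coset_eq[OF assms] by blast
qed

lemma ext_class_in_H2: "ext_class L A E \<in> carrier (H2 L A)"
proof -
  obtain s where "normalised s" using ex_normalised by blast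
  then show ?thesis
    unfolding H2_def carrier_FactGroup
    using ext_class_eq section_cocycle_in_Z2 by blast
qed

text \<open>A member of the coset is the cocycle of a fixed section plus the coboundary of some t;
  shifting the section by t realises it exactly.\<close>

lemma ext_class_section:
  assumes "z \<in> ext_class L A E"
  obtains s where "normalised s" "section_cocycle L A E s = z"
proof -
  obtain s where n: "normalised s" using ex_normalised by blast
  then have "s \<in> sections L E" by (simp add: normalised_def)
  then obtain f g where fg: "represents s f g" "section_cocycle L A E s = (f, g)"
    using represents_section_cocycle by blast
  obtain t where t: "t \<in> carrier L \<rightarrow> carrier A" "t \<zero>\<^bsub>L\<^esub> = \<zero>\<^bsub>A\<^esub>"
    and z: "z = coboundary L A t \<otimes>\<^bsub>Z2 L A\<^esub> (f, g)"
    using assms by (auto simp: ext_class_eq[OF n] r_coset_def B2_def fg(2))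
  show thesis
    using that represents_shift[OF n fg(1) t refl] z by metis
qed

text \<open>A homomorphic section is automatically normalised and has zero cocycle; the coset of
  zero is \<open>B2 L A\<close>, the unit of H2.\<close>

lemma split_ext_class:
  assumes "split_ext L E"
  shows "ext_class L A E = \<one>\<^bsub>H2 L A\<^esub>"
proof -
  interpret Z: comm_group "Z2 L A" by (rule comm_group_Z2)
  obtain s where s: "s \<in> sections L E" and h: "s \<in> lie_hom L B"
    using assms by (auto simp: split_ext_def)
  have n: "normalised s"
    using s lie_hom_zero[OF L.lie_ring_axioms B.lie_ring_axioms h] by (simp add: normalised_def)
  have "represents s (\<lambda>p \<in> carrier L \<times> carrier L. \<zero>\<^bsub>A\<^esub>) (\<lambda>p \<in> carrier L \<times> carrier L. \<zero>\<^bsub>A\<^esub>)"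
    using h by (auto simp: represents_def lie_hom_def L.bracket_closed B.bracket_closed Pi_iff)
  then have "section_cocycle L A E s = \<one>\<^bsub>Z2 L A\<^esub>"
    unfolding one_Z2 by (rule section_cocycle_eqI[OF s])
  then show ?thesis
    using Z.coset_join2[OF Z.one_closed subgroup_B2 subgroup.one_closed[OF subgroup_B2]]
    by (simp add: ext_class_eq[OF n] H2_def)
qed

end

section \<open>Equivalence of extensions and equality of classes\<close>

context lie_pair
begin

text \<open>Applying the middle map to the equations of \<open>represents\<close> changes neither f
  nor g. The two middle types are independent, so that a cocycle extension on pairs can be compared
  with its copy in another type.\<close>

lemma equivalent_imp_ext_class_eq:
  assumes E: "central_extension L A E" and E': "central_extension L A E'"
    and eq: "equivalent_ext L A E E'"
  shows "ext_class L A E = ext_class L A E'"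
proof -
  interpret E: central_ext L A E by unfold_locales fact
  interpret E': central_ext L A E' by unfold_locales fact
  obtain \<gamma> where \<gamma>: "\<gamma> \<in> lie_hom E.B E'.B" and i: "\<And>a. a \<in> carrier A \<Longrightarrow> \<gamma> (E.i a) = E'.i a"
    and p: "\<And>b. b \<in> carrier E.B \<Longrightarrow> E'.p (\<gamma> b) = E.p b"
    using eq by (auto simp: equivalent_ext_def)
  have \<gamma>_closed: "\<gamma> b \<in> carrier E'.B" if "b \<in> carrier E.B" for b
    using \<gamma> that by (auto simp: lie_hom_def)
  have hom: "\<gamma> (b \<oplus>\<^bsub>E.B\<^esub> c) = \<gamma> b \<oplus>\<^bsub>E'.B\<^esub> \<gamma> c" "\<gamma> (b \<otimes>\<^bsub>E.B\<^esub> c) = \<gamma> b \<otimes>\<^bsub>E'.B\<^esub> \<gamma> c"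
    if "b \<in> carrier E.B" "c \<in> carrier E.B" for b c
    using \<gamma> that by (auto simp: lie_hom_def)
  obtain s where n: "E.normalised s" using E.ex_normalised by blast
  then have s: "s \<in> sections L E" and s0: "s \<zero>\<^bsub>L\<^esub> = \<zero>\<^bsub>E.B\<^esub>" by (auto simp: E.normalised_def)
  note c = E.section_closed[OF s] E.p_section[OF s]
  obtain f g where fg: "E.represents s f g" "section_cocycle L A E s = (f, g)"
    using E.represents_section_cocycle[OF s] .
  have s': "(\<lambda>x. \<gamma> (s x)) \<in> sections L E'"
    using c p \<gamma>_closed by (auto simp: sections_def)
  then have n': "E'.normalised (\<lambda>x. \<gamma> (s x))"
    using lie_hom_zero[OF E.B.lie_ring_axioms E'.B.lie_ring_axioms \<gamma>]
    by (simp add: E'.normalised_def s0)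
  have "E'.represents (\<lambda>x. \<gamma> (s x)) f g"
    unfolding E'.represents_def
  proof (intro conjI ballI)
    show f: "f \<in> carrier L \<times> carrier L \<rightarrow>\<^sub>E carrier A" and g: "g \<in> carrier L \<times> carrier L \<rightarrow>\<^sub>E carrier A"
      using fg(1) by (auto simp: E.represents_def)
    fix x y assume xy: "x \<in> carrier L" "y \<in> carrier L"
    then have *: "f (x, y) \<in> carrier A" "g (x, y) \<in> carrier A" using f g by auto
    have "\<gamma> (s x \<otimes>\<^bsub>E.B\<^esub> s y) = \<gamma> (E.i (f (x, y)) \<oplus>\<^bsub>E.B\<^esub> s (x \<otimes>\<^bsub>L\<^esub> y))"
      "\<gamma> (s x \<oplus>\<^bsub>E.B\<^esub> s y) = \<gamma> (E.i (g (x, y)) \<oplus>\<^bsub>E.B\<^esub> s (x \<oplus>\<^bsub>L\<^esub> y))"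
      using fg(1) xy by (auto simp: E.represents_def)
    then show "\<gamma> (s x) \<otimes>\<^bsub>E'.B\<^esub> \<gamma> (s y) = E'.i (f (x, y)) \<oplus>\<^bsub>E'.B\<^esub> \<gamma> (s (x \<otimes>\<^bsub>L\<^esub> y))"
      and "\<gamma> (s x) \<oplus>\<^bsub>E'.B\<^esub> \<gamma> (s y) = E'.i (g (x, y)) \<oplus>\<^bsub>E'.B\<^esub> \<gamma> (s (x \<oplus>\<^bsub>L\<^esub> y))"
      using xy * by (simp_all add: hom c i L.bracket_closed)
  qed
  then have "section_cocycle L A E' (\<lambda>x. \<gamma> (s x)) = section_cocycle L A E s"
    unfolding fg(2) by (rule E'.section_cocycle_eqI[OF s'])
  then show ?thesis
    by (simp add: E.ext_class_eq[OF n] E'.ext_class_eq[OF n'])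
qed

lemma ext_class_eq_imp_equivalent:
  assumes E: "central_extension L A E" and E': "central_extension L A E'"
    and eq: "ext_class L A E = ext_class L A E'"
  shows "equivalent_ext L A E E'"
proof -
  interpret E: central_ext L A E by unfold_locales fact
  interpret E': central_ext L A E' by unfold_locales fact
  interpret Z: comm_group "Z2 L A" by (rule comm_group_Z2)
  obtain s where n: "E.normalised s" using E.ex_normalised by blast
  then have s: "s \<in> sections L E" and s0: "s \<zero>\<^bsub>L\<^esub> = \<zero>\<^bsub>E.B\<^esub>" by (auto simp: E.normalised_def)
  obtain f g where fg: "E.represents s f g" "section_cocycle L A E s = (f, g)"
    using E.represents_section_cocycle[OF s] .
  \<comment> \<open>This cocycle lies in the common class, so E' has a section with literally the
    same f and g. For an unadjusted section the map below would fail to be a homomorphism by a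
    coboundary.\<close>
  have "section_cocycle L A E s \<in> ext_class L A E"
    unfolding E.ext_class_eq[OF n]
    using E.section_cocycle_in_Z2[OF n] subgroup_B2 by (rule Z.rcos_self)
  then obtain s' where n': "E'.normalised s'" and eq': "section_cocycle L A E' s' = (f, g)"
    unfolding fg(2) eq using E'.ext_class_section by blast
  then have s': "s' \<in> sections L E'" and s'0: "s' \<zero>\<^bsub>L\<^esub> = \<zero>\<^bsub>E'.B\<^esub>" by (auto simp: E'.normalised_def)
  have fg': "E'.represents s' f g"
    using E'.represents_section_cocycle[OF s'] eq' by (metis prod.inject)
  note c = E.section_closed[OF s] E.p_section[OF s] E'.section_closed[OF s'] E'.p_section[OF s']
  \<comment> \<open>The difference is the A-coordinate of b relative to s; \<gamma> keeps both
    coordinates and exchanges the section.\<close>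
  define \<gamma> where "\<gamma> b = E'.i (inv_into (carrier A) E.i (b \<ominus>\<^bsub>E.B\<^esub> s (E.p b))) \<oplus>\<^bsub>E'.B\<^esub> s' (E.p b)" for b
  have \<gamma>: "\<gamma> (E.i a \<oplus>\<^bsub>E.B\<^esub> s x) = E'.i a \<oplus>\<^bsub>E'.B\<^esub> s' x" if "a \<in> carrier A" "x \<in> carrier L" for a x
    using that E.inv_into_diff[OF refl, of a "s x"] by (simp add: \<gamma>_def c)
  have decomp: "\<exists>a\<in>carrier A. \<exists>x\<in>carrier L. b = E.i a \<oplus>\<^bsub>E.B\<^esub> s x" if b: "b \<in> carrier E.B" for b
  proof -
    have "s (E.p b) \<in> carrier E.B" "E.p b = E.p (s (E.p b))"
      using that by (simp_all add: c)
    then obtain a where "a \<in> carrier A" "b = E.i a \<oplus>\<^bsub>E.B\<^esub> s (E.p b)"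
      using E.fibre[OF b] by blast
    with b show ?thesis using E.p_closed by blast
  qed
  have "\<gamma> \<in> lie_hom E.B E'.B"
    unfolding lie_hom_def mem_Collect_eq
  proof (intro conjI ballI)
    show "\<gamma> \<in> carrier E.B \<rightarrow> carrier E'.B"
      using decomp \<gamma> by (fastforce simp: c)
    fix b b' assume "b \<in> carrier E.B" "b' \<in> carrier E.B"
    then obtain a x a' x' where ax [simp]: "a \<in> carrier A" "x \<in> carrier L" "a' \<in> carrier A" "x' \<in> carrier L"
      and b: "b = E.i a \<oplus>\<^bsub>E.B\<^esub> s x" "b' = E.i a' \<oplus>\<^bsub>E.B\<^esub> s x'"
      using decomp by meson
    have [simp]: "f (x, x') \<in> carrier A" "g (x, x') \<in> carrier A"
      and e: "s x \<otimes>\<^bsub>E.B\<^esub> s x' = E.i (f (x, x')) \<oplus>\<^bsub>E.B\<^esub> s (x \<otimes>\<^bsub>L\<^esub> x')"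
        "s x \<oplus>\<^bsub>E.B\<^esub> s x' = E.i (g (x, x')) \<oplus>\<^bsub>E.B\<^esub> s (x \<oplus>\<^bsub>L\<^esub> x')"
      and e': "s' x \<otimes>\<^bsub>E'.B\<^esub> s' x' = E'.i (f (x, x')) \<oplus>\<^bsub>E'.B\<^esub> s' (x \<otimes>\<^bsub>L\<^esub> x')"
        "s' x \<oplus>\<^bsub>E'.B\<^esub> s' x' = E'.i (g (x, x')) \<oplus>\<^bsub>E'.B\<^esub> s' (x \<oplus>\<^bsub>L\<^esub> x')"
      using fg(1) fg' ax by (auto simp: E.represents_def E'.represents_def)
    note [simp] = c L.bracket_closed E.B.bracket_closed E'.B.bracket_closed
    have "b \<oplus>\<^bsub>E.B\<^esub> b' = E.i a \<oplus>\<^bsub>E.B\<^esub> E.i a' \<oplus>\<^bsub>E.B\<^esub> (s x \<oplus>\<^bsub>E.B\<^esub> s x')"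
      by (simp add: b E.B.a_ac)
    also have "\<dots> = E.i (a \<oplus>\<^bsub>A\<^esub> a' \<oplus>\<^bsub>A\<^esub> g (x, x')) \<oplus>\<^bsub>E.B\<^esub> s (x \<oplus>\<^bsub>L\<^esub> x')"
      by (simp add: e E.i_add E.B.a_assoc)
    finally have "\<gamma> (b \<oplus>\<^bsub>E.B\<^esub> b') = E'.i (a \<oplus>\<^bsub>A\<^esub> a' \<oplus>\<^bsub>A\<^esub> g (x, x')) \<oplus>\<^bsub>E'.B\<^esub> s' (x \<oplus>\<^bsub>L\<^esub> x')"
      by (simp add: \<gamma>)
    also have "\<dots> = E'.i a \<oplus>\<^bsub>E'.B\<^esub> E'.i a' \<oplus>\<^bsub>E'.B\<^esub> (s' x \<oplus>\<^bsub>E'.B\<^esub> s' x')"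
      by (simp add: e' E'.i_add E'.B.a_assoc)
    also have "\<dots> = \<gamma> b \<oplus>\<^bsub>E'.B\<^esub> \<gamma> b'"
      by (simp add: b \<gamma> E'.B.a_ac)
    finally show "\<gamma> (b \<oplus>\<^bsub>E.B\<^esub> b') = \<gamma> b \<oplus>\<^bsub>E'.B\<^esub> \<gamma> b'" .
    \<comment> \<open>The A-parts are central, so the bracket depends on the section values
      alone.\<close>
    have "\<gamma> (b \<otimes>\<^bsub>E.B\<^esub> b') = \<gamma> (s x \<otimes>\<^bsub>E.B\<^esub> s x')"
      by (simp add: b E.B.bracket_add_left E.B.bracket_add_right)
    also have "\<dots> = s' x \<otimes>\<^bsub>E'.B\<^esub> s' x'"
      by (simp add: e e' \<gamma>)
    also have "\<dots> = \<gamma> b \<otimes>\<^bsub>E'.B\<^esub> \<gamma> b'"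
      by (simp add: b \<gamma> E'.B.bracket_add_left E'.B.bracket_add_right)
    finally show "\<gamma> (b \<otimes>\<^bsub>E.B\<^esub> b') = \<gamma> b \<otimes>\<^bsub>E'.B\<^esub> \<gamma> b'" .
  qed
  moreover have "\<gamma> (E.i a) = E'.i a" if "a \<in> carrier A" for a
    using \<gamma>[OF that L.zero_closed] that by (simp add: s0 s'0)
  moreover have "E'.p (\<gamma> b) = E.p b" if b: "b \<in> carrier E.B" for b
  proof -
    obtain a x where "a \<in> carrier A" "x \<in> carrier L" "b = E.i a \<oplus>\<^bsub>E.B\<^esub> s x"
      using decomp[OF b] by blast
    then show ?thesis by (simp add: \<gamma> c)
  qed
  ultimately show ?thesis
    unfolding equivalent_ext_def by blast
qed

section \<open>Realising cocycles by extensions\<close>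

text \<open>The pair (a, x) stands for i a + s x. The bracket ignores first coordinates because
  these are to be central; that the zero slot is neutral rests on \<open>Z2_zero\<close>.\<close>

definition cocycle_ring :: "('l \<times> 'l \<Rightarrow> 'a) \<Rightarrow> ('l \<times> 'l \<Rightarrow> 'a) \<Rightarrow> ('a \<times> 'l) ring" where
  "cocycle_ring f g =
     \<lparr>carrier = carrier A \<times> carrier L,
      mult = (\<lambda>(a, x) (b, y). (f (x, y), x \<otimes>\<^bsub>L\<^esub> y)),
      one = (\<zero>\<^bsub>A\<^esub>, \<zero>\<^bsub>L\<^esub>),
      zero = (\<zero>\<^bsub>A\<^esub>, \<zero>\<^bsub>L\<^esub>),
      add = (\<lambda>(a, x) (b, y). (a \<oplus>\<^bsub>A\<^esub> b \<oplus>\<^bsub>A\<^esub> g (x, y), x \<oplus>\<^bsub>L\<^esub> y))\<rparr>"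

definition cocycle_ext :: "('l \<times> 'l \<Rightarrow> 'a) \<Rightarrow> ('l \<times> 'l \<Rightarrow> 'a) \<Rightarrow> ('a, 'a \<times> 'l, 'l) extension" where
  "cocycle_ext f g = \<lparr>mid = cocycle_ring f g, incl = (\<lambda>a. (a, \<zero>\<^bsub>L\<^esub>)), proj = snd\<rparr>"

text \<open>Cocycles are not assumed to be normalised; it is the alternating law \<open>f (x, x) = 0\<close>,
  through the additivity of \<open>f\<close> at \<open>0\<close>, that forces \<open>g (0, 0) = 0\<close>.\<close>

lemma Z2_zero:
  assumes 1: "(f, g) \<in> Z2_set L A" and x: "x \<in> carrier L"
  shows "g (x, \<zero>\<^bsub>L\<^esub>) = \<zero>\<^bsub>A\<^esub>" "g (\<zero>\<^bsub>L\<^esub>, x) = \<zero>\<^bsub>A\<^esub>" "f (\<zero>\<^bsub>L\<^esub>, x) = \<zero>\<^bsub>A\<^esub>" "f (x, \<zero>\<^bsub>L\<^esub>) = \<zero>\<^bsub>A\<^esub>"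
proof -
  note [simp] = Z2_D(3,4)[OF 1]
  have g00: "g (\<zero>\<^bsub>L\<^esub>, \<zero>\<^bsub>L\<^esub>) = \<zero>\<^bsub>A\<^esub>"
    using Z2_D(5)[OF 1, of "\<zero>\<^bsub>L\<^esub>" "\<zero>\<^bsub>L\<^esub>" "\<zero>\<^bsub>L\<^esub>"] by (simp add: Z2_D(7)[OF 1])
  show g: "g (x, \<zero>\<^bsub>L\<^esub>) = \<zero>\<^bsub>A\<^esub>"
    using Z2_D(9)[OF 1, of x "\<zero>\<^bsub>L\<^esub>" "\<zero>\<^bsub>L\<^esub>"] x by (simp add: g00)
  then show "g (\<zero>\<^bsub>L\<^esub>, x) = \<zero>\<^bsub>A\<^esub>"
    using Z2_D(10)[OF 1, of x "\<zero>\<^bsub>L\<^esub>"] x by simp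
  show "f (\<zero>\<^bsub>L\<^esub>, x) = \<zero>\<^bsub>A\<^esub>"
    using Z2_D(5)[OF 1, of "\<zero>\<^bsub>L\<^esub>" "\<zero>\<^bsub>L\<^esub>" x] x by (simp add: g00)
  show "f (x, \<zero>\<^bsub>L\<^esub>) = \<zero>\<^bsub>A\<^esub>"
    using Z2_D(6)[OF 1, of x "\<zero>\<^bsub>L\<^esub>" "\<zero>\<^bsub>L\<^esub>"] x by (simp add: g00)
qed

text \<open>The correspondence between laws and conditions in \<open>represents_in_Z2\<close>, read
  backwards.\<close>

lemma lie_ring_cocycle_ring:
  assumes 1: "(f, g) \<in> Z2_set L A"
  shows "lie_ring (cocycle_ring f g)" (is "lie_ring ?B")
proof -
  note [simp] = Z2_D(3,4)[OF 1] Z2_zero[OF 1] L.bracket_closed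
  have [simp]: "carrier ?B = carrier A \<times> carrier L" "\<zero>\<^bsub>?B\<^esub> = (\<zero>\<^bsub>A\<^esub>, \<zero>\<^bsub>L\<^esub>)"
    "(a, x) \<otimes>\<^bsub>?B\<^esub> (b, y) = (f (x, y), x \<otimes>\<^bsub>L\<^esub> y)"
    "(a, x) \<oplus>\<^bsub>?B\<^esub> (b, y) = (a \<oplus>\<^bsub>A\<^esub> b \<oplus>\<^bsub>A\<^esub> g (x, y), x \<oplus>\<^bsub>L\<^esub> y)" for a b x y
    by (simp_all add: cocycle_ring_def)
  have "abelian_group ?B"
  proof (rule abelian_groupI)
    fix u v w assume "u \<in> carrier ?B" "v \<in> carrier ?B" "w \<in> carrier ?B"
    then obtain a x b y c z where uvw: "u = (a, x)" "v = (b, y)" "w = (c, z)"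
      and [simp]: "a \<in> carrier A" "b \<in> carrier A" "c \<in> carrier A"
        "x \<in> carrier L" "y \<in> carrier L" "z \<in> carrier L"
      by auto
    have "a \<oplus>\<^bsub>A\<^esub> b \<oplus>\<^bsub>A\<^esub> g (x, y) \<oplus>\<^bsub>A\<^esub> c \<oplus>\<^bsub>A\<^esub> g (x \<oplus>\<^bsub>L\<^esub> y, z) =
        a \<oplus>\<^bsub>A\<^esub> b \<oplus>\<^bsub>A\<^esub> c \<oplus>\<^bsub>A\<^esub> (g (x \<oplus>\<^bsub>L\<^esub> y, z) \<oplus>\<^bsub>A\<^esub> g (x, y))"
      by (simp add: A.a_ac)
    also have "\<dots> = a \<oplus>\<^bsub>A\<^esub> b \<oplus>\<^bsub>A\<^esub> c \<oplus>\<^bsub>A\<^esub> (g (x, y \<oplus>\<^bsub>L\<^esub> z) \<oplus>\<^bsub>A\<^esub> g (y, z))"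
      by (simp add: Z2_D(9)[OF 1])
    also have "\<dots> = a \<oplus>\<^bsub>A\<^esub> (b \<oplus>\<^bsub>A\<^esub> c \<oplus>\<^bsub>A\<^esub> g (y, z)) \<oplus>\<^bsub>A\<^esub> g (x, y \<oplus>\<^bsub>L\<^esub> z)"
      by (simp add: A.a_ac)
    finally show "u \<oplus>\<^bsub>?B\<^esub> v \<oplus>\<^bsub>?B\<^esub> w = u \<oplus>\<^bsub>?B\<^esub> (v \<oplus>\<^bsub>?B\<^esub> w)"
      by (simp add: uvw L.a_assoc)
  next
    fix u v assume "u \<in> carrier ?B" "v \<in> carrier ?B"
    then show "u \<oplus>\<^bsub>?B\<^esub> v = v \<oplus>\<^bsub>?B\<^esub> u"
      by (auto simp: A.a_comm L.a_comm Z2_D(10)[OF 1])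
  next
    fix u assume "u \<in> carrier ?B"
    then obtain a x where u: "u = (a, x)" and [simp]: "a \<in> carrier A" "x \<in> carrier L"
      by auto
    have "(\<ominus>\<^bsub>A\<^esub> b) \<oplus>\<^bsub>A\<^esub> (\<ominus>\<^bsub>A\<^esub> c) \<oplus>\<^bsub>A\<^esub> b \<oplus>\<^bsub>A\<^esub> c = \<zero>\<^bsub>A\<^esub>" if "b \<in> carrier A" "c \<in> carrier A" for b c
      using that by algebra
    \<comment> \<open>The first coordinate of the inverse has to cancel both a and the term g (-x,
      x) contributed by the addition.\<close>
    then show "\<exists>v\<in>carrier ?B. v \<oplus>\<^bsub>?B\<^esub> u = \<zero>\<^bsub>?B\<^esub>"
      by (intro bexI[of _ "((\<ominus>\<^bsub>A\<^esub> a) \<oplus>\<^bsub>A\<^esub> (\<ominus>\<^bsub>A\<^esub> g (\<ominus>\<^bsub>L\<^esub> x, x)), \<ominus>\<^bsub>L\<^esub> x)"])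
        (simp_all add: u L.l_neg)
  qed auto
  then interpret B: abelian_group ?B .
  show ?thesis
  proof unfold_locales
    fix u v w assume "u \<in> carrier ?B" "v \<in> carrier ?B" "w \<in> carrier ?B"
    then obtain a x b y c z where uvw: "u = (a, x)" "v = (b, y)" "w = (c, z)"
      and [simp]: "a \<in> carrier A" "b \<in> carrier A" "c \<in> carrier A"
        "x \<in> carrier L" "y \<in> carrier L" "z \<in> carrier L"
      by auto
    show "(u \<oplus>\<^bsub>?B\<^esub> v) \<otimes>\<^bsub>?B\<^esub> w = (u \<otimes>\<^bsub>?B\<^esub> w) \<oplus>\<^bsub>?B\<^esub> (v \<otimes>\<^bsub>?B\<^esub> w)"
      by (simp add: uvw Z2_D(5)[OF 1] L.bracket_add_left)
    show "u \<otimes>\<^bsub>?B\<^esub> (v \<oplus>\<^bsub>?B\<^esub> w) = (u \<otimes>\<^bsub>?B\<^esub> v) \<oplus>\<^bsub>?B\<^esub> (u \<otimes>\<^bsub>?B\<^esub> w)"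
      by (simp add: uvw Z2_D(6)[OF 1] L.bracket_add_right)
    \<comment> \<open>The summands stand in the order of the cocycle condition, so adding them
      passes through - [y, [z, x]] and produces exactly its two g terms; the reordering
      follows.\<close>
    have "(u \<otimes>\<^bsub>?B\<^esub> (v \<otimes>\<^bsub>?B\<^esub> w)) \<oplus>\<^bsub>?B\<^esub> (w \<otimes>\<^bsub>?B\<^esub> (u \<otimes>\<^bsub>?B\<^esub> v)) \<oplus>\<^bsub>?B\<^esub> (v \<otimes>\<^bsub>?B\<^esub> (w \<otimes>\<^bsub>?B\<^esub> u)) = \<zero>\<^bsub>?B\<^esub>"
      using Z2_D(8)[OF 1, of x y z] by (simp add: uvw L.bracket_cyclic L.l_neg A.a_ac)
    then show "(u \<otimes>\<^bsub>?B\<^esub> (v \<otimes>\<^bsub>?B\<^esub> w)) \<oplus>\<^bsub>?B\<^esub> (v \<otimes>\<^bsub>?B\<^esub> (w \<otimes>\<^bsub>?B\<^esub> u)) \<oplus>\<^bsub>?B\<^esub> (w \<otimes>\<^bsub>?B\<^esub> (u \<otimes>\<^bsub>?B\<^esub> v)) = \<zero>\<^bsub>?B\<^esub>"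
      by (subst B.a_assoc, simp add: uvw, simp add: uvw, simp add: uvw,
          subst B.a_comm[of "v \<otimes>\<^bsub>?B\<^esub> (w \<otimes>\<^bsub>?B\<^esub> u)"], simp add: uvw, simp add: uvw,
          subst B.a_assoc[symmetric], simp_all add: uvw)
  qed (auto simp: Z2_D(7)[OF 1] L.bracket_self)
qed

text \<open>That a -> (a, 0) preserves brackets uses that A is abelian: such pairs have bracket (f
  (0, 0), 0), which is zero. Centrality comes from f (0, x) = 0.\<close>

lemma central_extension_cocycle_ext:
  assumes 1: "(f, g) \<in> Z2_set L A"
  shows "central_extension L A (cocycle_ext f g)"
  unfolding central_extension_def
proof (intro conjI)
  note [simp] = Z2_D(3,4)[OF 1] Z2_zero[OF 1] L.bracket_closed
  show "lie_ring (mid (cocycle_ext f g))"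
    by (simp add: cocycle_ext_def lie_ring_cocycle_ring[OF 1])
qed (auto simp: cocycle_ext_def cocycle_ring_def lie_hom_def lie_center_def a_kernel_def'
      inj_on_def A.bracket_zero Z2_zero[OF 1] image_iff Bex_def)

text \<open>The section x -> (0, x) is normalised and recovers (f, g) exactly, because (a, 0) + (0,
  x) = (a, x).\<close>

lemma ext_class_cocycle_ext:
  assumes 1: "(f, g) \<in> Z2_set L A"
  shows "ext_class L A (cocycle_ext f g) = B2 L A #>\<^bsub>Z2 L A\<^esub> (f, g)"
proof -
  interpret E: central_ext L A "cocycle_ext f g"
    by unfold_locales (rule central_extension_cocycle_ext[OF 1])
  let ?s = "\<lambda>x. (\<zero>\<^bsub>A\<^esub>, x)"
  have s: "?s \<in> sections L (cocycle_ext f g)"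
    by (auto simp: sections_def cocycle_ext_def cocycle_ring_def)
  then have n: "E.normalised ?s"
    by (simp add: E.normalised_def) (simp add: cocycle_ext_def cocycle_ring_def)
  have "E.represents ?s f g"
    unfolding E.represents_def using Z2_D(1-4)[OF 1]
    by (auto simp: cocycle_ext_def cocycle_ring_def Z2_zero[OF 1] L.bracket_closed)
  then show ?thesis
    by (simp add: E.ext_class_eq[OF n] E.section_cocycle_eqI[OF s])
qed

text \<open>Cocycle extensions live on pairs, whereas the classification fixes an arbitrary middle
  type. The structure is carried along h, and h itself is the equivalence.\<close>

lemma central_extension_transport:
  fixes E :: "('a, 'b, 'l) extension" and h :: "'b \<Rightarrow> 'c"
  assumes E: "central_extension L A E" and h: "inj_on h (carrier (mid E))"
  obtains E' :: "('a, 'c, 'l) extension"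
  where "central_extension L A E'" "equivalent_ext L A E E'"
proof -
  interpret E: central_ext L A E by unfold_locales fact
  define k where "k = inv_into (carrier E.B) h"
  have k [simp]: "k (h b) = b" if "b \<in> carrier E.B" for b
    using h that by (simp add: k_def)
  define C where "C =
     \<lparr>carrier = h ` carrier E.B,
      mult = (\<lambda>u v. h (k u \<otimes>\<^bsub>E.B\<^esub> k v)),
      one = h \<one>\<^bsub>E.B\<^esub>,
      zero = h \<zero>\<^bsub>E.B\<^esub>,
      add = (\<lambda>u v. h (k u \<oplus>\<^bsub>E.B\<^esub> k v))\<rparr>"
  have C: "carrier C = h ` carrier E.B" "\<zero>\<^bsub>C\<^esub> = h \<zero>\<^bsub>E.B\<^esub>"
    "u \<otimes>\<^bsub>C\<^esub> v = h (k u \<otimes>\<^bsub>E.B\<^esub> k v)" "u \<oplus>\<^bsub>C\<^esub> v = h (k u \<oplus>\<^bsub>E.B\<^esub> k v)" for u v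
    by (simp_all add: C_def)
  have hom: "h \<in> lie_hom E.B C"
    by (auto simp: lie_hom_def C)
  have "lie_ring C"
    using E.B.lie_ring_axioms hom by (rule lie_ring_transport) (simp_all add: C)
  define E' where "E' = \<lparr>mid = C, incl = (\<lambda>a. h (E.i a)), proj = (\<lambda>u. E.p (k u))\<rparr>"
  have E': "mid E' = C" "incl E' a = h (E.i a)" "proj E' u = E.p (k u)" for a u
    by (simp_all add: E'_def)
  have "central_extension L A E'"
    unfolding central_extension_def E'(1)
  proof (intro conjI)
    show "incl E' \<in> lie_hom A C"
      by (auto simp: lie_hom_def E' C E.i_add A.bracket_zero)
    show "proj E' \<in> lie_hom C L"
      by (auto simp: lie_hom_def E' C E.B.bracket_closed)
    show "inj_on (incl E') (carrier A)"
      by (rule inj_onI) (use h in \<open>simp add: E' inj_on_eq_iff E.i_inject\<close>)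
    have "incl E' ` carrier A = h ` E.i ` carrier A"
      by (auto simp: E')
    also have "\<dots> = a_kernel C L (proj E')"
      unfolding E.i_image a_kernel_def' by (auto simp: E' C)
    finally show "incl E' ` carrier A = a_kernel C L (proj E')" .
    show "proj E' ` carrier C = carrier L"
      using E.p_surj by (auto simp: E' C image_image)
    show "incl E' ` carrier A \<subseteq> lie_center C"
      by (auto simp: lie_center_def E' C)
  qed fact
  moreover have "equivalent_ext L A E E'"
    unfolding equivalent_ext_def E' using hom by (auto intro!: bexI[of _ h])
  ultimately show thesis using that by blast
qed

text \<open>The size hypothesis supplies the injection that moves a cocycle extension into 'b; the
  copy is equivalent to the original and so keeps the class.\<close>

lemma ext_class_surj:
  assumes universe: "carrier A \<times> carrier L \<lesssim> (UNIV :: 'b set)" and c: "c \<in> carrier (H2 L A)"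
  obtains E :: "('a, 'b, 'l) extension" where "central_extension L A E" "ext_class L A E = c"
proof -
  obtain f g where fg: "(f, g) \<in> Z2_set L A" and c: "c = B2 L A #>\<^bsub>Z2 L A\<^esub> (f, g)"
    using c by (auto simp: H2_def carrier_FactGroup)
  obtain h :: "'a \<times> 'l \<Rightarrow> 'b" where h: "inj_on h (carrier A \<times> carrier L)"
    using universe by (auto simp: lepoll_def)
  have "carrier (mid (cocycle_ext f g)) = carrier A \<times> carrier L"
    by (simp add: cocycle_ext_def cocycle_ring_def)
  with h obtain E :: "('a, 'b, 'l) extension"
    where E: "central_extension L A E" "equivalent_ext L A (cocycle_ext f g) E"
    using central_extension_transport[OF central_extension_cocycle_ext[OF fg], of h] by metis
  then have "ext_class L A E = c"
    using equivalent_imp_ext_class_eq[OF central_extension_cocycle_ext[OF fg] E]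
    by (simp add: c ext_class_cocycle_ext[OF fg])
  with E that show thesis by blast
qed

end

text \<open>The bijection concerns one middle type 'b; the third conjunct allows two different ones,
  so the class is a complete invariant across types.\<close>

theorem proposition4p4:
  fixes L :: "'l ring" and A :: "'a ring"
  assumes "lie_ring L"
    and "abelian_lie_ring A"
    and universe: "carrier A \<times> carrier L \<lesssim> (UNIV :: 'b set)"
  shows "equiv (central_extensions L A :: ('a, 'b, 'l) extension set) (ext_equiv L A) \<and>
     bij_betw (\<lambda>X. the_elem (ext_class L A ` X))
       ((central_extensions L A :: ('a, 'b, 'l) extension set) // ext_equiv L A)
       (carrier (H2 L A)) \<and>
     (\<forall>E \<in> (central_extensions L A :: ('a, 'b, 'l) extension set).
        \<forall>E' \<in> (central_extensions L A :: ('a, 'c, 'l) extension set).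
          equivalent_ext L A E E' \<longleftrightarrow> ext_class L A E = ext_class L A E') \<and>
     (\<forall>E \<in> (central_extensions L A :: ('a, 'b, 'l) extension set).
        split_ext L E \<longrightarrow> ext_class L A E = \<one>\<^bsub>H2 L A\<^esub>)"
proof -
  interpret lie_pair L A
    using assms(1,2) by (simp add: lie_pair_def)
  let ?X = "central_extensions L A :: ('a, 'b, 'l) extension set"
  let ?r = "ext_equiv L A :: (('a, 'b, 'l) extension \<times> ('a, 'b, 'l) extension) set"
  have loc: "central_ext L A E" if "E \<in> ?X" for E
    using that by (intro central_ext.intro central_ext_axioms.intro lie_pair_axioms)
      (simp add: central_extensions_def)
  \<comment> \<open>As the kernel of the class map, the relation inherits reflexivity, symmetry and
    transitivity from equality.\<close>
  have r: "?r = {(E, E'). E \<in> ?X \<and> E' \<in> ?X \<and> ext_class L A E = ext_class L A E'}"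
    using equivalent_imp_ext_class_eq ext_class_eq_imp_equivalent
    by (auto simp: ext_equiv_def central_extensions_def)
  have equiv: "equiv ?X ?r"
    unfolding r by (rule equivI) (auto simp: refl_on_def sym_def trans_def)
  \<comment> \<open>The class map is constant on an equivalence class, so its image there is a
    singleton and \<open>the_elem\<close> returns the common value.\<close>
  have cls: "the_elem (ext_class L A ` (?r `` {E})) = ext_class L A E" if "E \<in> ?X" for E
  proof -
    have "ext_class L A ` (?r `` {E}) = {ext_class L A E}"
      using that by (auto simp: r)
    then show ?thesis by simp
  qed
  have "bij_betw (\<lambda>X. the_elem (ext_class L A ` X)) (?X // ?r) (carrier (H2 L A))"
  proof (rule bij_betw_imageI)
    show "inj_on (\<lambda>X. the_elem (ext_class L A ` X)) (?X // ?r)"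
    proof (rule inj_onI)
      fix U V assume "U \<in> ?X // ?r" "V \<in> ?X // ?r"
        and eq: "the_elem (ext_class L A ` U) = the_elem (ext_class L A ` V)"
      then obtain E E' where E: "E \<in> ?X" "U = ?r `` {E}" "E' \<in> ?X" "V = ?r `` {E'}"
        by (auto elim!: quotientE)
      with eq have "(E, E') \<in> ?r" by (simp add: cls) (simp add: r)
      then show "U = V"
        unfolding E using equiv_class_eq[OF equiv] by blast
    qed
    show "(\<lambda>X. the_elem (ext_class L A ` X)) ` (?X // ?r) = carrier (H2 L A)"
    proof (intro equalityI subsetI)
      fix c assume "c \<in> (\<lambda>X. the_elem (ext_class L A ` X)) ` (?X // ?r)"
      then obtain E where "E \<in> ?X" "c = ext_class L A E"
        by (auto elim!: quotientE simp: cls)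
      then show "c \<in> carrier (H2 L A)"
        using central_ext.ext_class_in_H2[OF loc] by simp
    next
      fix c assume "c \<in> carrier (H2 L A)"
      then obtain E :: "('a, 'b, 'l) extension" where E: "E \<in> ?X" "ext_class L A E = c"
        using ext_class_surj[OF universe] by (auto simp: central_extensions_def)
      then have "c = the_elem (ext_class L A ` (?r `` {E}))" by (simp add: cls)
      with E(1) show "c \<in> (\<lambda>X. the_elem (ext_class L A ` X)) ` (?X // ?r)"
        by (blast intro: quotientI)
    qed
  qed
  moreover have "equivalent_ext L A E E' \<longleftrightarrow> ext_class L A E = ext_class L A E'"
    if "E \<in> ?X" "E' \<in> (central_extensions L A :: ('a, 'c, 'l) extension set)" for E E'
    using that equivalent_imp_ext_class_eq ext_class_eq_imp_equivalent
    by (auto simp: central_extensions_def)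
  moreover have "ext_class L A E = \<one>\<^bsub>H2 L A\<^esub>" if "E \<in> ?X" "split_ext L E" for E
    using central_ext.split_ext_class[OF loc] that by blast
  ultimately show ?thesis
    using equiv by blast
qed

end
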